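(* Let $\pi:(X,G)\to(Y,G)$ be a factor map between $G$-systems, $\Sigma=(M_i)_{i\ge1}$ a sofic approximation to $G$, and $\rho_1,\rho_2$ two 1-bounded dynamically generating continuous pseudometrics on $X$. Then $h_\Sigma(\rho_1|Y)=h_\Sigma(\rho_2|Y)$.
   Context: $G$ is a locally compact second countable group with identity $1_G$ and a fixed right Haar measure $\mathrm{Haar}$. A $G$-system $(X,G)$ is a compact metric space $X$ with a continuous action $G\times X\to X$, $(g,x)\mapsto gx$. A factor map $\pi:(X,G)\to(Y,G)$ is a continuous surjection with $\pi(gx)=g\pi(x)$. A pseudometric $\rho$ on $X$ is dynamically generating if for all $x\neq y$ there is $g\in G$ with $\rho(gx,gy)>0$, and 1-bounded if $\rho\le1$. Local $G$-spaces: a partial action of $G$ on a Hausdorff space $M$ is a continuous map $\alpha:\mathrm{dom}(\alpha)\to M$ with $\mathrm{dom}(\alpha)\subset G\times M$ open, written $g.p=\alpha(g,p)$, such that for all $p\in M$: (1) $(1_G,p)\in\mathrm{dom}(\alpha)$ and $1_G.p=p$; (2) if $(g,p)\in\mathrm{dom}(\alpha)$ then $(g^{-1},g.p)\in\mathrm{dom}(\alpha)$ and $g^{-1}.(g.p)=p$; (3) if $(h,p),(g,h.p),(gh,p)\in\mathrm{dom}(\alpha)$ then $(gh).p=g.(h.p)$; (4) there is an open neighborhood $O_p$ of $1_G$ with $O_p\times\{p\}\subset\mathrm{dom}(\alpha)$ such that $g\mapsto g.p$ is a homeomorphism of $O_p$ onto an open neighborhood of $p$. Such $M$ is a local $G$-space.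 It carries a unique Radon measure $\mathrm{vol}$ such that whenever $f_p$ is a homeomorphism from an open neighborhood of $p$ onto an open neighborhood of $1_G$ with $g.p$ defined and $f_p(g.p)=g$ for all $g$ in its range, and $K\subset\mathrm{dom}(f_p)$ is Borel, then $\mathrm{vol}(K)=\mathrm{Haar}(f_p(K))$. For a precompact open $U\subset G$, $M[U]$ is the set of $p\in M$ such that (a) whenever $g,h,gh\in U$, both $g.(h.p)$ and $(gh).p$ are defined and equal, and (b) $g\mapsto g.p$ is a homeomorphism from $U$ onto an open neighborhood of $p$. $M$ is a $(U,\epsilon)$-sofic approximation if $\mathrm{vol}(M)<\infty$ and $\mathrm{vol}(M[U])\ge(1-\epsilon)\mathrm{vol}(M)$. A sofic approximation to $G$ is a sequence $\Sigma=(M_i)_{i\ge1}$ with $M_i$ a $(U_i,\epsilon_i)$-sofic approximation, where $U_1\subset U_2\subset\cdots$ are precompact open sets with $\bigcup_iU_i=G$ and $\epsilon_i\to0$; $G$ is assumed sofic. Maps: for finite-volume $M$, $\overline{\mathrm{vol}}=\mathrm{vol}/\mathrm{vol}(M)$; $\mathrm{Map}(M,X)$ is the set of measurable maps $M\to X$. For a pseudometric $\rho$ on $X$ and measurable maps $\varphi,\psi$ defined on subsets of $M$, with $D$ the intersection of their domains, $\rho^M(\varphi,\psi)=\overline{\mathrm{vol}}(M\setminus D)+\int_D\rho(\varphi(p),\psi(p))\,d\overline{\mathrm{vol}}(p)$. For $g\in G$, $(\varphi\circ g)(p)=\varphi(g.p)$ wherever defined, $(g\circ\varphi)(p)=g\varphi(p)$.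 For a precompact neighborhood $U$ of $1_G$ and $\delta>0$, $\mathrm{Map}(M,X,\rho:U,\delta)$ is the set of $\varphi\in\mathrm{Map}(M,X)$ with $\rho^M(\varphi\circ g,g\circ\varphi)<\delta$ for all $g\in U$. A subset $S$ of a pseudometric space $(Z,d)$ is $(d,\epsilon)$-separated if $d(a,b)>\epsilon$ for all distinct $a,b\in S$. Relative entropy: for $\Phi\subset\mathrm{Map}(M,X)$ and a continuous pseudometric $\rho_X$ on $X$, $N_\epsilon(\Phi;\rho_X^M|Y)$ is the maximal cardinality of a $(\rho_X^M,\epsilon)$-separated subset $\Phi_0\subset\Phi$ with $\pi\circ\varphi=\pi\circ\psi$ for all $\varphi,\psi\in\Phi_0$. Then $h_\Sigma^\epsilon(\rho_X|Y)=\inf_U\inf_{\delta>0}\limsup_{i\to\infty}\frac{1}{\mathrm{vol}(M_i)}\log N_\epsilon(\mathrm{Map}(M_i,X,\rho_X:U,\delta);\rho_X^{M_i}|Y)$, the infimum over all precompact neighborhoods $U$ of $1_G$ (with $\log0=-\infty$), and $h_\Sigma(\rho_X|Y)=\sup_{\epsilon>0}h_\Sigma^\epsilon(\rho_X|Y)$. *)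

theory Defs
  imports "HOL-Analysis.Analysis" "HOL-Library.Liminf_Limsup"
begin

text \<open>Conventions. The group G is a type 'g of class group_add, written additively:
 the product gh is g + h, the identity 1_G is 0, and g^{-1} is - g.\<close>

definition borel_of :: "'a topology \<Rightarrow> 'a measure" where
  "borel_of T = sigma (topspace T) (Collect (openin T))"

definition radon_on :: "'a topology \<Rightarrow> 'a measure \<Rightarrow> bool" where
  "radon_on T \<mu> \<longleftrightarrow>
     sets \<mu> = sets (borel_of T) \<and>
     (\<forall>K. compactin T K \<longrightarrow> emeasure \<mu> K < \<infinity>) \<and>
     (\<forall>B\<in>sets \<mu>. emeasure \<mu> B = (INF U\<in>{U. openin T U \<and> B \<subseteq> U}. emeasure \<mu> U)) \<and>
     (\<forall>U. openin T U \<longrightarrow> emeasure \<mu> U = (SUP K\<in>{K. compactin T K \<and> K \<subseteq> U}. emeasure \<mu> K))"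

definition lcsc_group_right_haar :: "'g::{group_add,t2_space,second_countable_topology} measure \<Rightarrow> bool" where
  "lcsc_group_right_haar Haar \<longleftrightarrow>
     continuous_on UNIV (\<lambda>z::'g\<times>'g. fst z + snd z) \<and>
     continuous_on UNIV (uminus :: 'g \<Rightarrow> 'g) \<and>
     locally_compact_space (euclidean :: 'g topology) \<and>
     radon_on euclidean Haar \<and>
     emeasure Haar (space Haar) \<noteq> 0 \<and>
     (\<forall>A\<in>sets Haar. \<forall>g. emeasure Haar ((\<lambda>x. x + g) ` A) = emeasure Haar A)"

definition G_system :: "('g::{group_add,topological_space} \<Rightarrow> 'x::metric_space \<Rightarrow> 'x) \<Rightarrow> bool" where
  "G_system act \<longleftrightarrow>
     compact (UNIV :: 'x set) \<and>
     continuous_on UNIV (\<lambda>z::'g\<times>'x. act (fst z) (snd z)) \<and>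
     (\<forall>x. act 0 x = x) \<and>
     (\<forall>g h x. act (g + h) x = act g (act h x))"

definition factor_map ::
  "('g::group_add \<Rightarrow> 'x::topological_space \<Rightarrow> 'x) \<Rightarrow> ('g \<Rightarrow> 'y::topological_space \<Rightarrow> 'y) \<Rightarrow> ('x \<Rightarrow> 'y) \<Rightarrow> bool" where
  "factor_map actX actY \<pi> \<longleftrightarrow>
     continuous_on UNIV \<pi> \<and> surj \<pi> \<and> (\<forall>g x. \<pi> (actX g x) = actY g (\<pi> x))"

definition good_pseudometric ::
  "('g \<Rightarrow> 'x::topological_space \<Rightarrow> 'x) \<Rightarrow> ('x \<Rightarrow> 'x \<Rightarrow> real) \<Rightarrow> bool" where
  "good_pseudometric act \<rho> \<longleftrightarrow>
     continuous_on UNIV (\<lambda>z::'x\<times>'x. \<rho> (fst z) (snd z)) \<and>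
     (\<forall>x. \<rho> x x = 0) \<and> (\<forall>x y. \<rho> x y = \<rho> y x) \<and>
     (\<forall>x y z. \<rho> x z \<le> \<rho> x y + \<rho> y z) \<and>
     (\<forall>x y. 0 \<le> \<rho> x y \<and> \<rho> x y \<le> 1) \<and>
     (\<forall>x y. x \<noteq> y \<longrightarrow> (\<exists>g. \<rho> (act g x) (act g y) > 0))"

text \<open>Partial action: M a Hausdorff space, D = dom(alpha) open in G x M, alpha g p = g.p .\<close>
definition local_G_space ::
  "'m topology \<Rightarrow> ('g::{group_add,topological_space} \<times> 'm) set \<Rightarrow> ('g \<Rightarrow> 'm \<Rightarrow> 'm) \<Rightarrow> bool" where
  "local_G_space M D \<alpha> \<longleftrightarrow>
     Hausdorff_space M \<and>
     D \<subseteq> UNIV \<times> topspace M \<and>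
     openin (prod_topology euclidean M) D \<and>
     continuous_map (subtopology (prod_topology euclidean M) D) M (\<lambda>z. \<alpha> (fst z) (snd z)) \<and>
     (\<forall>p\<in>topspace M.
        ((0, p) \<in> D \<and> \<alpha> 0 p = p) \<and>
        (\<forall>g. (g, p) \<in> D \<longrightarrow> (- g, \<alpha> g p) \<in> D \<and> \<alpha> (- g) (\<alpha> g p) = p) \<and>
        (\<forall>g h. (h, p) \<in> D \<longrightarrow> (g, \<alpha> h p) \<in> D \<longrightarrow> (g + h, p) \<in> D \<longrightarrow>
               \<alpha> (g + h) p = \<alpha> g (\<alpha> h p)) \<and>
        (\<exists>Op. open Op \<and> 0 \<in> Op \<and> Op \<times> {p} \<subseteq> D \<and>
             openin M ((\<lambda>g. \<alpha> g p) ` Op) \<and> p \<in> (\<lambda>g. \<alpha> g p) ` Op \<and>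
             homeomorphic_map (subtopology euclidean Op) (subtopology M ((\<lambda>g. \<alpha> g p) ` Op))
               (\<lambda>g. \<alpha> g p)))"

text \<open>vol is the (unique) Radon measure on M with the local chart property.\<close>
definition local_vol ::
  "'g::{group_add,topological_space} measure \<Rightarrow> 'm topology \<Rightarrow> ('g \<times> 'm) set \<Rightarrow> ('g \<Rightarrow> 'm \<Rightarrow> 'm)
    \<Rightarrow> 'm measure \<Rightarrow> bool" where
  "local_vol Haar M D \<alpha> vol \<longleftrightarrow>
     radon_on M vol \<and>
     (\<forall>p V f. p \<in> V \<longrightarrow> openin M V \<longrightarrow> open (f ` V) \<longrightarrow> 0 \<in> f ` V \<longrightarrow>
        homeomorphic_map (subtopology M V) (subtopology euclidean (f ` V)) f \<longrightarrow>
        (\<forall>g\<in>f ` V. (g, p) \<in> D \<and> \<alpha> g p \<in> V \<and> f (\<alpha> g p) = g) \<longrightarrow>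
        (\<forall>K. K \<subseteq> V \<longrightarrow> K \<in> sets vol \<longrightarrow> emeasure vol K = emeasure Haar (f ` K)))"

definition good_set ::
  "'m topology \<Rightarrow> ('g::{group_add,topological_space} \<times> 'm) set \<Rightarrow> ('g \<Rightarrow> 'm \<Rightarrow> 'm) \<Rightarrow> 'g set \<Rightarrow> 'm set" where
  "good_set M D \<alpha> U = {p \<in> topspace M.
     (\<forall>g h. g \<in> U \<longrightarrow> h \<in> U \<longrightarrow> g + h \<in> U \<longrightarrow>
        (h, p) \<in> D \<and> (g, \<alpha> h p) \<in> D \<and> (g + h, p) \<in> D \<and> \<alpha> g (\<alpha> h p) = \<alpha> (g + h) p) \<and>
     U \<times> {p} \<subseteq> D \<and>
     openin M ((\<lambda>g. \<alpha> g p) ` U) \<and> p \<in> (\<lambda>g. \<alpha> g p) ` U \<and>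
     homeomorphic_map (subtopology euclidean U) (subtopology M ((\<lambda>g. \<alpha> g p) ` U)) (\<lambda>g. \<alpha> g p)}"

definition sofic_approx ::
  "'g::{group_add,topological_space} measure \<Rightarrow> (nat \<Rightarrow> 'm topology) \<Rightarrow> (nat \<Rightarrow> ('g \<times> 'm) set)
    \<Rightarrow> (nat \<Rightarrow> 'g \<Rightarrow> 'm \<Rightarrow> 'm) \<Rightarrow> (nat \<Rightarrow> 'm measure) \<Rightarrow> bool" where
  "sofic_approx Haar M D \<alpha> vol \<longleftrightarrow>
     (\<forall>i. local_G_space (M i) (D i) (\<alpha> i) \<and> local_vol Haar (M i) (D i) (\<alpha> i) (vol i)) \<and>
     (\<exists>U \<epsilon>. (\<forall>i. open (U i) \<and> compact (closure (U i))) \<and> incseq U \<and> (\<Union>i. U i) = UNIV \<and>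
        \<epsilon> \<longlonglongrightarrow> 0 \<and>
        (\<forall>i. emeasure (vol i) (space (vol i)) < \<infinity> \<and>
             emeasure (vol i) (good_set (M i) (D i) (\<alpha> i) (U i))
               \<ge> ennreal (1 - \<epsilon> i) * emeasure (vol i) (space (vol i))))"

text \<open>rho^M(F, G) for maps F, G defined (at least) on the measurable set Dm of M:
 normalized volume of the complement plus the normalized integral over Dm.\<close>
definition rhoM :: "'m measure \<Rightarrow> ('x \<Rightarrow> 'x \<Rightarrow> real) \<Rightarrow> 'm set \<Rightarrow> ('m \<Rightarrow> 'x) \<Rightarrow> ('m \<Rightarrow> 'x) \<Rightarrow> ennreal" where
  "rhoM vol \<rho> Dm F G =
     (emeasure vol (space vol - Dm) + (\<integral>\<^sup>+ p. indicator Dm p * ennreal (\<rho> (F p) (G p)) \<partial>vol))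
     / emeasure vol (space vol)"

definition Map_approx ::
  "('g \<Rightarrow> 'x::topological_space \<Rightarrow> 'x) \<Rightarrow> ('g \<times> 'm) set \<Rightarrow> ('g \<Rightarrow> 'm \<Rightarrow> 'm)
    \<Rightarrow> 'm measure \<Rightarrow> ('x \<Rightarrow> 'x \<Rightarrow> real) \<Rightarrow> 'g set \<Rightarrow> real \<Rightarrow> ('m \<Rightarrow> 'x) set" where
  "Map_approx act D \<alpha> vol \<rho> U \<delta> = {\<phi> \<in> measurable vol borel.
     \<forall>g\<in>U. rhoM vol \<rho> {p \<in> space vol. (g, p) \<in> D} (\<lambda>p. \<phi> (\<alpha> g p)) (\<lambda>p. act g (\<phi> p))
            < ennreal \<delta>}"

definition N_rel :: "real \<Rightarrow> ('m \<Rightarrow> 'x) set \<Rightarrow> 'm measure \<Rightarrow> ('x \<Rightarrow> 'x \<Rightarrow> real) \<Rightarrow> ('x \<Rightarrow> 'y) \<Rightarrow> ereal" where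
  "N_rel \<epsilon> \<Phi> vol \<rho> \<pi> = (SUP S \<in> {S. finite S \<and> S \<subseteq> \<Phi> \<and>
        (\<forall>\<phi>\<in>S. \<forall>\<psi>\<in>S. \<phi> \<noteq> \<psi> \<longrightarrow> rhoM vol \<rho> (space vol) \<phi> \<psi> > ennreal \<epsilon>) \<and>
        (\<forall>\<phi>\<in>S. \<forall>\<psi>\<in>S. \<forall>p\<in>space vol. \<pi> (\<phi> p) = \<pi> (\<psi> p))}. ereal (real (card S)))"

definition elog :: "ereal \<Rightarrow> ereal" where
  "elog x = (if x \<le> 0 then -\<infinity> else if x = \<infinity> then \<infinity> else ereal (ln (real_of_ereal x)))"

definition rel_entropy_eps ::
  "('g::{group_add,topological_space} \<Rightarrow> 'x::topological_space \<Rightarrow> 'x) \<Rightarrow> ('x \<Rightarrow> 'y) \<Rightarrow> (nat \<Rightarrow> ('g \<times> 'm) set)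
    \<Rightarrow> (nat \<Rightarrow> 'g \<Rightarrow> 'm \<Rightarrow> 'm) \<Rightarrow> (nat \<Rightarrow> 'm measure) \<Rightarrow> ('x \<Rightarrow> 'x \<Rightarrow> real) \<Rightarrow> real \<Rightarrow> ereal" where
  "rel_entropy_eps act \<pi> D \<alpha> vol \<rho> \<epsilon> =
     (INF U \<in> {U. 0 \<in> interior U \<and> compact (closure U)}. INF \<delta> \<in> {0<..}.
        limsup (\<lambda>i. ereal (1 / measure (vol i) (space (vol i))) *
          elog (N_rel \<epsilon> (Map_approx act (D i) (\<alpha> i) (vol i) \<rho> U \<delta>) (vol i) \<rho> \<pi>)))"

definition rel_entropy ::
  "('g::{group_add,topological_space} \<Rightarrow> 'x::topological_space \<Rightarrow> 'x) \<Rightarrow> ('x \<Rightarrow> 'y) \<Rightarrow> (nat \<Rightarrow> ('g \<times> 'm) set)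
    \<Rightarrow> (nat \<Rightarrow> 'g \<Rightarrow> 'm \<Rightarrow> 'm) \<Rightarrow> (nat \<Rightarrow> 'm measure) \<Rightarrow> ('x \<Rightarrow> 'x \<Rightarrow> real) \<Rightarrow> ereal" where
  "rel_entropy act \<pi> D \<alpha> vol \<rho> = (SUP \<epsilon> \<in> {0<..}. rel_entropy_eps act \<pi> D \<alpha> vol \<rho> \<epsilon>)"

end

theory Submission
  imports Defs
begin

text \<open>
  By compactness, for every \<open>\<eta> > 0\<close> there are a finite \<open>F\<close> and a constant \<open>B\<close> with
  \<open>\<rho>1 x y \<le> \<eta> + B * (\<Sum>g\<in>F. \<rho>2 (g x) (g y))\<close>. Integrating over \<open>M\<^sub>i\<close> and replacing \<open>g \<phi>(p)\<close> by
  \<open>\<phi>(g.p)\<close>, this shows that \<open>\<rho>1\<close>-separated approximately equivariant maps are \<open>\<rho>2\<close>-separated, and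
  that approximate equivariance for one pseudometric implies it for the other, on the large set
  where \<open>g.(h.p) = (gh).p\<close>. Both steps change variables by \<open>p \<mapsto> g.p\<close>, which in the charts of a local
  \<open>G\<close>-space is a conjugation; by the uniqueness of Haar measure it scales \<open>vol\<close> by the modular
  function of \<open>G\<close>, which is bounded on compact sets.
\<close>

section \<open>Uniqueness of right Haar measure\<close>

text \<open>Three points shape the argument. The topologies \<open>M i\<close> are not assumed
  second countable, so chart estimates cannot be glued over countably many charts: the distortion
  bound is proved on finite unions of chart pieces, hence on compact sets, and then carried to open
  and to Borel sets by inner and outer regularity of the Radon measure. Next, the order of
  quantifiers: the supremum over \<epsilon> stands outside the infimum over U and \<delta>, so the
  new \<open>\<epsilon>'\<close> may depend on \<open>\<epsilon>\<close> alone, while U and \<delta>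
  for \<open>\<rho>1\<close> may depend on the pair \<open>U'\<close>, \<open>\<delta>'\<close>
  prescribed for \<open>\<rho>2\<close>. Finally, separation passes to \<open>\<rho>2\<close> only
  for maps that are almost equivariant for \<open>\<rho>2\<close> at the finitely many elements that
  dominate \<open>\<rho>1\<close>; equivariance is therefore transferred first, to \<open>U'\<close>
  enlarged by these elements. The maps themselves are never altered, so the fibre condition over Y
  is inherited.\<close>

lemma sets_borel_of_euclidean: "sets (borel_of euclidean) = sets borel"
  by (simp add: borel_of_def borel_def)

locale right_haar =
  fixes Haar :: "'g::{group_add,t2_space,second_countable_topology} measure"
  assumes lcsc: "lcsc_group_right_haar Haar"
begin

lemma continuous_plus: "continuous_on UNIV (\<lambda>z::'g\<times>'g. fst z + snd z)"
  and continuous_uminus: "continuous_on UNIV (uminus :: 'g \<Rightarrow> 'g)"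
  and sets_Haar: "sets Haar = sets borel"
  and Haar_compact_finite: "compact K \<Longrightarrow> emeasure Haar K < \<infinity>"
  and Haar_nonzero: "emeasure Haar UNIV \<noteq> 0"
  and Haar_right_translate: "A \<in> sets borel \<Longrightarrow> emeasure Haar ((\<lambda>x. x + g) ` A) = emeasure Haar A"
  and Haar_inner_regular: "open U \<Longrightarrow> emeasure Haar U = (SUP K\<in>{K. compact K \<and> K \<subseteq> U}. emeasure Haar K)"
proof -
  show *: "sets Haar = sets borel"
    using lcsc by (simp add: lcsc_group_right_haar_def radon_on_def sets_borel_of_euclidean)
  have "space Haar = UNIV"
    using sets_eq_imp_space_eq[OF *] by simp
  then show "emeasure Haar UNIV \<noteq> 0"
    using lcsc by (simp add: lcsc_group_right_haar_def)
  show "A \<in> sets borel \<Longrightarrow> emeasure Haar ((\<lambda>x. x + g) ` A) = emeasure Haar A"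
    using lcsc by (simp add: lcsc_group_right_haar_def *)
qed (use lcsc in \<open>auto simp: lcsc_group_right_haar_def radon_on_def\<close>)

lemma space_Haar: "space Haar = UNIV"
  using sets_eq_imp_space_eq[OF sets_Haar] by simp

section \<open>Translations, open sets and compact sets in the group\<close>

lemma continuous_on_group_add:
  assumes "continuous_on S f" "continuous_on S (g :: 'a::topological_space \<Rightarrow> 'g)"
  shows "continuous_on S (\<lambda>x. f x + g x)"
  using continuous_on_compose2[OF continuous_plus continuous_on_Pair[OF assms]] by simp

lemma continuous_on_group_minus:
  assumes "continuous_on S (f :: 'a::topological_space \<Rightarrow> 'g)"
  shows "continuous_on S (\<lambda>x. - f x)"
  using continuous_on_compose2[OF continuous_uminus assms] by simp

lemma continuous_on_group_diff:
  assumes "continuous_on S f" "continuous_on S (g :: 'a::topological_space \<Rightarrow> 'g)"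
  shows "continuous_on S (\<lambda>x. f x - g x)"
  unfolding diff_conv_add_uminus
  by (intro continuous_on_group_add continuous_on_group_minus assms)

lemmas continuous_group_intros =
  continuous_on_group_add continuous_on_group_diff continuous_on_group_minus
  continuous_on_const continuous_on_id continuous_on_fst continuous_on_snd

lemma measurable_of_continuous:
  assumes "continuous_on UNIV f" "sets M = sets borel"
  shows "f \<in> measurable M borel"
  using borel_measurable_continuous_onI[OF assms(1)] measurable_cong_sets[OF assms(2) refl] by blast

lemma left_translate_eq_vimage: "(\<lambda>x. g + x) ` S = (\<lambda>x. - g + x) -` (S::'g set)"
  by (auto simp: image_iff) (metis add.assoc add.left_inverse add.right_inverse add_0)

lemma open_left_translate: "open (S::'g set) \<Longrightarrow> open ((\<lambda>x. g + x) ` S)"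
  unfolding left_translate_eq_vimage
  by (intro open_vimage continuous_group_intros)

lemma open_right_translate: "open (S::'g set) \<Longrightarrow> open ((\<lambda>x. x + g) ` S)"
proof -
  assume "open S"
  have "(\<lambda>x. x + g) ` S = (\<lambda>x. x - g) -` S"
    by (auto simp: image_iff) (metis diff_add_cancel)
  then show ?thesis
    using open_vimage[OF \<open>open S\<close>, of "\<lambda>x. x - g"] by (simp add: continuous_group_intros)
qed

lemma borel_left_translate: "S \<in> sets borel \<Longrightarrow> (\<lambda>x. g + x) ` S \<in> sets (borel::'g measure)"
  unfolding left_translate_eq_vimage
  by (intro measurable_sets_borel[where M = borel] measurable_of_continuous continuous_group_intros) auto

lemma compact_nbhd: "\<exists>V K. open V \<and> compact K \<and> (x::'g) \<in> V \<and> V \<subseteq> K"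
proof -
  have "locally_compact_space (euclidean :: 'g topology)"
    using lcsc by (simp add: lcsc_group_right_haar_def)
  then show ?thesis
    by (auto simp: locally_compact_space_def)
qed

text \<open>If \<open>S\<close> were null, so would be all its right translates. The translate
  \<open>T x\<close> moves a point \<open>s\<close> of \<open>S\<close> to \<open>x\<close>, so
  finitely many of them cover any compact set; inner regularity would then make the whole group
  null.\<close>

lemma Haar_open_pos:
  assumes "open S" "S \<noteq> {}" shows "emeasure Haar S > 0"
proof (rule ccontr)
  assume "\<not> emeasure Haar S > 0"
  then have S0: "emeasure Haar S = 0" by simp
  obtain s where s: "s \<in> S" using assms by auto
  have K0: "emeasure Haar K = 0" if K: "compact K" for K
  proof -
    define T where "T x = (\<lambda>y. y + (- s + x)) ` S" for x
    have T: "open (T x)" "x \<in> T x" for x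
      unfolding T_def using open_right_translate[OF assms(1), of "- s + x"] s
      by (auto intro!: image_eqI[of _ _ s] simp: add.assoc[symmetric] simp del: add_uminus_conv_diff)
    obtain F where F: "finite F" "K \<subseteq> (\<Union>x\<in>F. T x)"
      by (rule compactE_image[OF K, of UNIV T]) (auto intro: T)
    have "emeasure Haar K \<le> emeasure Haar (\<Union>x\<in>F. T x)"
      using F T by (intro emeasure_mono) (auto simp: sets_Haar)
    also have "\<dots> \<le> (\<Sum>x\<in>F. emeasure Haar (T x))"
      using T F by (intro emeasure_subadditive_finite) (auto simp: sets_Haar)
    also have "\<dots> = 0"
      unfolding T_def using Haar_right_translate[of S] S0 assms by simp
    finally show ?thesis by simp
  qed
  have "emeasure Haar UNIV = 0"
    unfolding Haar_inner_regular[OF open_UNIV] using K0 by (intro antisym SUP_least) auto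
  then show False using Haar_nonzero by simp
qed

text \<open>Second countability enters here, through the Lindelof property. The result turns
  finiteness on compact sets into sigma-finiteness, which Fubini needs.\<close>

lemma sigma_compact: "\<exists>K :: nat \<Rightarrow> 'g set. (\<forall>i. compact (K i)) \<and> (\<Union>i. K i) = UNIV"
proof -
  have "\<forall>x. \<exists>V K. open V \<and> compact K \<and> (x::'g) \<in> V \<and> V \<subseteq> K"
    using compact_nbhd by blast
  then obtain O' K where OK: "\<And>x::'g. open (O' x) \<and> compact (K x) \<and> x \<in> O' x \<and> O' x \<subseteq> K x"
    by metis
  obtain F where F: "F \<subseteq> range O'" "countable F" "\<Union>F = \<Union>(range O')"
    using Lindelof[of "range O'"] OK by blast
  obtain I where I: "countable I" "F = O' ` I"
    using F(1,2) by (metis countable_subset_image)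
  have "x \<in> (\<Union>x\<in>I. K x)" for x
  proof -
    have "x \<in> O' x" using OK by simp
    then have "x \<in> \<Union>F" unfolding F(3) by (rule UN_I[OF UNIV_I])
    then obtain y where "y \<in> I" "x \<in> O' y" unfolding I(2) by (rule UN_E)
    moreover have "O' y \<subseteq> K y" using OK by simp
    ultimately show ?thesis by blast
  qed
  then have U: "(\<Union>x\<in>I. K x) = UNIV" by blast
  then have "I \<noteq> {}" by auto
  then have "range (from_nat_into I) = I" using I by (simp add: range_from_nat_into)
  then have "(\<Union>i. K (from_nat_into I i)) = UNIV" using U by (metis image_image)
  then show ?thesis using OK by (intro exI[of _ "\<lambda>i. K (from_nat_into I i)"]) auto
qed

lemma sigma_finite_of_compact_finite:
  assumes "sets \<nu> = sets (borel :: 'g measure)" "\<And>K. compact K \<Longrightarrow> emeasure \<nu> K < \<infinity>"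
  shows "sigma_finite_measure \<nu>"
proof -
  obtain K :: "nat \<Rightarrow> 'g set" where K: "\<And>i. compact (K i)" "(\<Union>i. K i) = UNIV"
    using sigma_compact by blast
  show ?thesis
    by standard (use K assms sets_eq_imp_space_eq[OF assms(1)] in
      \<open>auto intro!: exI[of _ "range K"] simp: less_top[symmetric] borel_compact dest!: assms(2)[THEN less_imp_neq]\<close>)
qed

section \<open>Fubini and the uniqueness argument\<close>

lemma nn_integral_right_translate:
  assumes "sets \<nu> = sets (borel :: 'g measure)"
    and "\<And>A g. A \<in> sets borel \<Longrightarrow> emeasure \<nu> ((\<lambda>x. x + g) ` A) = emeasure \<nu> A"
    and f: "f \<in> borel_measurable borel"
  shows "(\<integral>\<^sup>+x. f (x + a) \<partial>\<nu>) = (\<integral>\<^sup>+x. f x \<partial>\<nu>)"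
proof -
  have m: "(\<lambda>x. x + a) \<in> measurable \<nu> borel"
    by (intro measurable_of_continuous continuous_group_intros assms)
  have sp: "space \<nu> = UNIV" using sets_eq_imp_space_eq[OF assms(1)] by simp
  have "distr \<nu> borel (\<lambda>x. x + a) = \<nu>"
  proof (rule measure_eqI)
    fix A assume "A \<in> sets (distr \<nu> borel (\<lambda>x. x + a))"
    then have A: "A \<in> sets borel" by simp
    have "(\<lambda>x. x + a) -` A = (\<lambda>x. x + (- a)) ` A"
      by (auto simp: image_iff) (metis add_diff_cancel)
    then show "emeasure (distr \<nu> borel (\<lambda>x. x + a)) A = emeasure \<nu> A"
      using A m assms(2)[of A "-a"] by (simp add: emeasure_distr sp)
  qed (simp add: assms)
  moreover have "(\<integral>\<^sup>+x. f (x + a) \<partial>\<nu>) = (\<integral>\<^sup>+x. f x \<partial>distr \<nu> borel (\<lambda>x. x + a))"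
    using m f by (simp add: nn_integral_distr)
  ultimately show ?thesis by simp
qed

text \<open>The shear \<open>(x, y) \<mapsto> (x + y, - x)\<close> preserves the product of right invariant measures.\<close>

lemma right_invariant_shear:
  assumes \<nu>: "sets \<nu> = sets (borel :: 'g measure)" "sigma_finite_measure \<nu>"
    and inv: "\<And>A g. A \<in> sets borel \<Longrightarrow> emeasure \<nu> ((\<lambda>x. x + g) ` A) = emeasure \<nu> A"
    and E: "E \<in> sets borel" and k: "k \<in> borel_measurable borel"
  shows "emeasure \<nu> E * (\<integral>\<^sup>+y. k (- y) \<partial>Haar) = (\<integral>\<^sup>+x. k x * emeasure Haar ((\<lambda>y. - x + y) ` E) \<partial>\<nu>)"
proof -
  interpret H: sigma_finite_measure Haar
    by (rule sigma_finite_of_compact_finite[OF sets_Haar Haar_compact_finite])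
  interpret N: sigma_finite_measure \<nu> by fact
  interpret P: pair_sigma_finite \<nu> Haar ..
  have pr: "sets (\<nu> \<Otimes>\<^sub>M Haar) = sets (borel :: ('g \<times> 'g) measure)"
    using sets_pair_measure_cong[OF \<nu>(1) sets_Haar] by (metis borel_prod)
  have m1: "(\<lambda>(x, y). indicator E x * k (x - y)) \<in> borel_measurable (\<nu> \<Otimes>\<^sub>M Haar)"
    unfolding split_beta
    using E by (intro borel_measurable_times_ennreal measurable_compose[OF _ k]
       measurable_compose[OF _ borel_measurable_indicator, of _ _ borel] measurable_of_continuous pr continuous_group_intros)
  have m2: "(\<lambda>(x, y). indicator E (x + y) * k x) \<in> borel_measurable (\<nu> \<Otimes>\<^sub>M Haar)"
    unfolding split_beta
    using E by (intro borel_measurable_times_ennreal measurable_compose[OF _ k]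
       measurable_compose[OF _ borel_measurable_indicator, of _ _ borel] measurable_of_continuous pr continuous_group_intros)
  have m3: "(\<lambda>x. indicator E x * k (x - y)) \<in> borel_measurable borel" for y
    using E by (intro borel_measurable_times_ennreal borel_measurable_indicator measurable_compose[OF _ k] measurable_of_continuous continuous_group_intros) auto
  have m4: "(\<lambda>y. k (- y)) \<in> borel_measurable borel"
    by (intro measurable_compose[OF _ k] measurable_of_continuous continuous_uminus) auto
  have "emeasure \<nu> E * (\<integral>\<^sup>+y. k (- y) \<partial>Haar) = (\<integral>\<^sup>+x. indicator E x * (\<integral>\<^sup>+y. k (- y) \<partial>Haar) \<partial>\<nu>)"
    using E \<nu> by (simp add: nn_integral_multc)
  \<comment> \<open>Only right translations are at hand. In the inner integral \<open>y\<close> is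
    translated by \<open>- x\<close>, which turns \<open>k (- y)\<close> into
    \<open>k (x - y)\<close>; after the exchange of integrals \<open>x\<close> is translated by
    \<open>y\<close>, which moves \<open>y\<close> into the indicator of \<open>E\<close>.
    Integrating over \<open>y\<close> first then produces a left translate of
    \<open>E\<close>.\<close>
  also have "\<dots> = (\<integral>\<^sup>+x. (\<integral>\<^sup>+y. indicator E x * k (x - y) \<partial>Haar) \<partial>\<nu>)"
  proof (rule nn_integral_cong)
    fix x
    have "(\<integral>\<^sup>+y. k (- y) \<partial>Haar) = (\<integral>\<^sup>+y. k (- (y + - x)) \<partial>Haar)"
      by (rule nn_integral_right_translate[OF sets_Haar Haar_right_translate m4, symmetric])
    moreover have "(\<lambda>y. k (x - y)) \<in> borel_measurable Haar"
      by (intro measurable_compose[OF _ k] measurable_of_continuous continuous_group_intros sets_Haar)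
    ultimately show "indicator E x * (\<integral>\<^sup>+y. k (- y) \<partial>Haar) = (\<integral>\<^sup>+y. indicator E x * k (x - y) \<partial>Haar)"
      by (simp add: nn_integral_cmult minus_add)
  qed
  also have "\<dots> = (\<integral>\<^sup>+y. (\<integral>\<^sup>+x. indicator E x * k (x - y) \<partial>\<nu>) \<partial>Haar)"
    using P.Fubini[OF m1] by simp
  also have "\<dots> = (\<integral>\<^sup>+y. (\<integral>\<^sup>+x. indicator E (x + y) * k x \<partial>\<nu>) \<partial>Haar)"
  proof (rule nn_integral_cong)
    fix y
    show "(\<integral>\<^sup>+x. indicator E x * k (x - y) \<partial>\<nu>) = (\<integral>\<^sup>+x. indicator E (x + y) * k x \<partial>\<nu>)"
      using nn_integral_right_translate[OF \<nu>(1) inv m3, of y y] by simp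
  qed
  also have "\<dots> = (\<integral>\<^sup>+x. (\<integral>\<^sup>+y. indicator E (x + y) * k x \<partial>Haar) \<partial>\<nu>)"
    using P.Fubini[OF m2] by simp
  also have "\<dots> = (\<integral>\<^sup>+x. k x * emeasure Haar ((\<lambda>y. - x + y) ` E) \<partial>\<nu>)"
  proof (rule nn_integral_cong)
    fix x
    have *: "indicator E (x + y) = (indicator ((\<lambda>y. - x + y) ` E) y :: ennreal)" for y
      unfolding left_translate_eq_vimage by (simp add: indicator_def)
    have "(\<lambda>y. - x + y) ` E \<in> sets Haar" using borel_left_translate[OF E] by (simp add: sets_Haar)
    then show "(\<integral>\<^sup>+y. indicator E (x + y) * k x \<partial>Haar) = k x * emeasure Haar ((\<lambda>y. - x + y) ` E)"
      unfolding * by (subst nn_integral_multc) (auto simp: mult.commute)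
  qed
  finally show ?thesis .
qed

text \<open>The shear identity is applied to the set \<open>W\<close> with \<open>k\<close> equal to
  the indicator of \<open>E\<close> divided by \<open>m\<close>, the factor on its right side; this
  is legitimate because \<open>m\<close> is positive and finite for a compact neighbourhood
  \<open>W\<close> of 0. The right side collapses to the measure of \<open>E\<close>, while the
  integral of \<open>k (- y)\<close> does not depend on the measure under study. Writing the
  identity for \<open>\<nu>\<close> and for \<open>Haar\<close> eliminates that integral.\<close>

lemma right_invariant_unique:
  assumes \<nu>: "sets \<nu> = sets (borel :: 'g measure)" "\<And>K. compact K \<Longrightarrow> emeasure \<nu> K < \<infinity>"
    and inv: "\<And>A g. A \<in> sets borel \<Longrightarrow> emeasure \<nu> ((\<lambda>x. x + g) ` A) = emeasure \<nu> A"
    and E: "E \<in> sets borel" and W: "compact W" "0 \<in> interior W"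
  shows "emeasure \<nu> E * emeasure Haar W = emeasure \<nu> W * emeasure Haar E"
proof -
  define m where "m x = emeasure Haar ((\<lambda>y. - x + y) ` W)" for x
  define k where "k x = indicator E x / m x" for x
  have Wb: "W \<in> sets borel" using W by (simp add: borel_compact)
  interpret H: sigma_finite_measure Haar
    by (rule sigma_finite_of_compact_finite[OF sets_Haar Haar_compact_finite])
  have pos: "m x > 0" for x
  proof -
    have "0 < emeasure Haar ((\<lambda>y. - x + y) ` interior W)"
      using W by (intro Haar_open_pos open_left_translate) auto
    also have "\<dots> \<le> m x"
      unfolding m_def using borel_left_translate[OF Wb] interior_subset
      by (intro emeasure_mono) (auto simp: sets_Haar)
    finally show ?thesis .
  qed
  have fin: "m x < \<infinity>" for x
    unfolding m_def using W
    by (intro Haar_compact_finite compact_continuous_image continuous_group_intros)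
  have mm: "m \<in> borel_measurable borel"
  proof -
    have pr: "sets (borel \<Otimes>\<^sub>M Haar) = sets (borel :: ('g \<times> 'g) measure)"
      using sets_pair_measure_cong[OF refl sets_Haar, of borel] by (metis borel_prod)
    have "(\<lambda>(x, y). indicator W (x + y)) \<in> borel_measurable (borel \<Otimes>\<^sub>M Haar)"
      unfolding split_beta
      using Wb by (intro measurable_compose[OF _ borel_measurable_indicator, of _ _ borel]
          measurable_of_continuous pr continuous_group_intros)
    then have "(\<lambda>x. \<integral>\<^sup>+y. indicator W (x + y) \<partial>Haar) \<in> borel_measurable borel"
      by (rule H.borel_measurable_nn_integral)
    moreover have "(\<integral>\<^sup>+y. indicator W (x + y) \<partial>Haar) = m x" for x
    proof -
      have *: "indicator W (x + y) = (indicator ((\<lambda>y. - x + y) ` W) y :: ennreal)" for y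
        unfolding left_translate_eq_vimage by (simp add: indicator_def)
      show ?thesis using borel_left_translate[OF Wb] unfolding * m_def by (simp add: sets_Haar)
    qed
    ultimately show ?thesis by simp
  qed
  have km: "k \<in> borel_measurable borel"
    unfolding k_def using E mm by measurable
  have J: "emeasure \<mu> W * (\<integral>\<^sup>+y. k (- y) \<partial>Haar) = emeasure \<mu> E"
    if \<mu>: "sets \<mu> = sets (borel :: 'g measure)" "\<And>K. compact K \<Longrightarrow> emeasure \<mu> K < \<infinity>"
      and inv: "\<And>A g. A \<in> sets borel \<Longrightarrow> emeasure \<mu> ((\<lambda>x. x + g) ` A) = emeasure \<mu> A" for \<mu>
  proof -
    have "emeasure \<mu> W * (\<integral>\<^sup>+y. k (- y) \<partial>Haar) = (\<integral>\<^sup>+x. k x * m x \<partial>\<mu>)"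
      unfolding m_def using sigma_finite_of_compact_finite[OF \<mu>]
      by (intro right_invariant_shear \<mu> inv km Wb)
    also have "\<dots> = (\<integral>\<^sup>+x. indicator E x \<partial>\<mu>)"
      unfolding k_def using pos fin
      by (intro nn_integral_cong) (auto simp: ennreal_divide_times less_top less_imp_neq[OF pos, symmetric] split: split_indicator)
    finally show ?thesis using E \<mu> by simp
  qed
  show ?thesis
    using J[OF \<nu> inv] J[OF sets_Haar Haar_compact_finite Haar_right_translate]
    by (metis mult.assoc mult.commute)
qed

text \<open>Left and right translations commute, so E |-> Haar(h + E) is again right invariant,
  hence a multiple of \<open>Haar\<close>. The factor is read off on one fixed compact neighbourhood
  \<open>W\<close> of 0 and is therefore controlled uniformly in \<open>h\<close>.\<close>

lemma Haar_left_translate_bound: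
  assumes L: "compact L"
  shows "\<exists>C::real. 0 < C \<and> (\<forall>h\<in>L. \<forall>E\<in>sets borel. emeasure Haar ((\<lambda>x. h + x) ` E) \<le> ennreal C * emeasure Haar E)"
proof -
  obtain O' W where W: "open O'" "compact W" "(0::'g) \<in> O'" "O' \<subseteq> W"
    using compact_nbhd by blast
  then have W0: "0 \<in> interior W" by (meson interior_maximal subsetD)
  have Wb: "W \<in> sets borel" using W by (simp add: borel_compact)
  \<comment> \<open>The sum set L + W contains h + W for every \<open>h\<close> in \<open>L\<close>,
    so Haar(S) / Haar(W) bounds all the factors at once.\<close>
  define S where "S = (\<lambda>z. fst z + snd z) ` (L \<times> W)"
  have "compact S"
    unfolding S_def using L W
    by (intro compact_continuous_image compact_Times) (auto intro: continuous_on_subset[OF continuous_plus])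
  then have S: "S \<in> sets borel" "emeasure Haar S < \<infinity>"
    using borel_compact Haar_compact_finite by auto
  have Wpos: "emeasure Haar W > 0"
  proof -
    have "0 < emeasure Haar O'" using W by (intro Haar_open_pos) auto
    also have "\<dots> \<le> emeasure Haar W" using W Wb by (intro emeasure_mono) (auto simp: sets_Haar)
    finally show ?thesis .
  qed
  have Wfin: "emeasure Haar W < \<infinity>" using W Haar_compact_finite by simp
  define C where "C = emeasure Haar S / emeasure Haar W"
  have Cfin: "C < \<infinity>"
    unfolding C_def using S Wpos by (auto simp: ennreal_divide_eq_top_iff less_top[symmetric])
  have "emeasure Haar ((\<lambda>x. h + x) ` E) \<le> C * emeasure Haar E"
    if h: "h \<in> L" and E: "E \<in> sets borel" for h E
  proof -
    define \<nu> where "\<nu> = distr Haar borel (\<lambda>x. - h + x)"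
    have m: "(\<lambda>x. - h + x) \<in> measurable Haar borel"
      by (intro measurable_of_continuous continuous_group_intros sets_Haar)
    have \<nu>: "emeasure \<nu> A = emeasure Haar ((\<lambda>x. h + x) ` A)" if "A \<in> sets borel" for A
      using that m by (simp add: \<nu>_def emeasure_distr left_translate_eq_vimage space_Haar)
    have "emeasure \<nu> E * emeasure Haar W = emeasure \<nu> W * emeasure Haar E"
    proof (rule right_invariant_unique[OF _ _ _ E W(2) W0])
      show "emeasure \<nu> K < \<infinity>" if "compact K" for K
        using that unfolding \<nu>[OF borel_compact[OF that]]
        by (intro Haar_compact_finite compact_continuous_image continuous_group_intros)
      fix A g assume A: "A \<in> sets (borel :: 'g measure)"
      have "(\<lambda>x. x + g) ` A = (\<lambda>x. x - g) -` A"
        by (auto simp: image_iff) (metis diff_add_cancel)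
      moreover have "(\<lambda>x. x - g) \<in> measurable borel (borel :: 'g measure)"
        by (intro measurable_of_continuous continuous_group_intros) simp
      ultimately have Ag: "(\<lambda>x. x + g) ` A \<in> sets borel"
        using A by (simp add: measurable_sets_borel)
      have "emeasure \<nu> ((\<lambda>x. x + g) ` A) = emeasure Haar ((\<lambda>x. x + g) ` (\<lambda>x. h + x) ` A)"
        using Ag by (simp add: \<nu> image_image add.assoc)
      also have "\<dots> = emeasure \<nu> A"
        using A borel_left_translate by (simp add: Haar_right_translate \<nu>)
      finally show "emeasure \<nu> ((\<lambda>x. x + g) ` A) = emeasure \<nu> A" .
    qed (simp add: \<nu>_def)
    moreover have "emeasure \<nu> W \<le> emeasure Haar S"
    proof -
      have "(\<lambda>x. h + x) ` W \<subseteq> S" using h unfolding S_def by force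
      then show ?thesis unfolding \<nu>[OF Wb] using S(1) by (intro emeasure_mono) (simp_all add: sets_Haar)
    qed
    ultimately have "emeasure \<nu> E * emeasure Haar W \<le> emeasure Haar S * emeasure Haar E"
      by (simp add: mult_right_mono)
    then have "emeasure \<nu> E \<le> emeasure Haar S * emeasure Haar E / emeasure Haar W"
      using divide_right_mono_ennreal[of "emeasure \<nu> E * emeasure Haar W" _ "emeasure Haar W"]
        ennreal_mult_divide_eq[of "emeasure Haar W" "emeasure \<nu> E"] Wpos Wfin by auto
    then show ?thesis
      using \<nu>[OF E] by (simp add: C_def ennreal_divide_times ennreal_times_divide)
  qed
  \<comment> \<open>\<open>C\<close> can vanish, for instance for empty \<open>L\<close>. Adding 1
    gives a positive real constant, by which later arguments divide.\<close>
  moreover have "C \<le> ennreal (enn2real C + 1)"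
    using Cfin by (simp add: ennreal_plus)
  ultimately have "emeasure Haar ((\<lambda>x. h + x) ` E) \<le> ennreal (enn2real C + 1) * emeasure Haar E"
    if "h \<in> L" "E \<in> sets borel" for h E
    using that by (meson mult_right_mono order_trans zero_le)
  moreover have "0 < enn2real C + 1" using enn2real_nonneg[of C] by linarith
  ultimately show ?thesis by blast
qed

end

section \<open>Volume distortion in local G-spaces\<close>

lemma sets_borel_of: "sets (borel_of T) = sigma_sets (topspace T) (Collect (openin T))"
  unfolding borel_of_def by (rule sets_measure_of) (auto dest: openin_subset)

lemma space_borel_of: "space (borel_of T) = topspace T"
  unfolding borel_of_def by (rule space_measure_of) (auto dest: openin_subset)

lemma openin_sets_borel_of: "openin T U \<Longrightarrow> U \<in> sets (borel_of T)"
  unfolding sets_borel_of by auto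

lemma measurable_continuous_map_open:
  assumes L: "sets L = sets (borel_of S)" and N: "sets N = sets (borel_of T)"
    and V: "openin S V" and f: "continuous_map (subtopology S V) T f"
  shows "f \<in> measurable (restrict_space L V) N"
proof (rule measurable_sigma_sets[of _ "topspace T" "Collect (openin T)"])
  have sL: "space L = topspace S" using sets_eq_imp_space_eq[OF L] space_borel_of by metis
  have VS: "V \<subseteq> topspace S" using V by (rule openin_subset)
  have sp: "space (restrict_space L V) = V" using VS by (auto simp: space_restrict_space sL)
  show "sets N = sigma_sets (topspace T) (Collect (openin T))" using N by (simp add: sets_borel_of)
  show "Collect (openin T) \<subseteq> Pow (topspace T)" by (auto dest: openin_subset)
  show "f \<in> space (restrict_space L V) \<rightarrow> topspace T"
    using f VS unfolding sp continuous_map_def by auto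
  fix U assume "U \<in> Collect (openin T)"
  then have "openin (subtopology S V) {x \<in> topspace (subtopology S V). f x \<in> U}"
    using f by (auto simp: continuous_map_def)
  moreover have "{x \<in> topspace (subtopology S V). f x \<in> U} = f -` U \<inter> V" using VS by auto
  ultimately have "openin S (f -` U \<inter> V)" using V by (simp add: openin_open_subtopology)
  then have "f -` U \<inter> V \<in> sets L" using openin_sets_borel_of L by blast
  then show "f -` U \<inter> space (restrict_space L V) \<in> sets (restrict_space L V)"
    unfolding sp sets_restrict_space by (metis Int_commute Int_left_absorb image_eqI)
qed

locale local_space = right_haar Haar
  for Haar :: "'g::{group_add,t2_space,second_countable_topology} measure" +
  fixes M :: "'m topology" and D :: "('g \<times> 'm) set" and \<alpha> :: "'g \<Rightarrow> 'm \<Rightarrow> 'm" and vol :: "'m measure"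
  assumes lgs: "local_G_space M D \<alpha>" and lvol: "local_vol Haar M D \<alpha> vol"
begin

lemma Hausdorff: "Hausdorff_space M"
  and D_subset: "D \<subseteq> UNIV \<times> topspace M"
  and open_D: "openin (prod_topology euclidean M) D"
  and continuous_\<alpha>: "continuous_map (subtopology (prod_topology euclidean M) D) M (\<lambda>z. \<alpha> (fst z) (snd z))"
  using lgs by (auto simp: local_G_space_def)

lemma act_zero: "p \<in> topspace M \<Longrightarrow> (0, p) \<in> D \<and> \<alpha> 0 p = p"
  and act_inverse: "(g, p) \<in> D \<Longrightarrow> (- g, \<alpha> g p) \<in> D \<and> \<alpha> (- g) (\<alpha> g p) = p"
  and act_add: "(h, p) \<in> D \<Longrightarrow> (g, \<alpha> h p) \<in> D \<Longrightarrow> (g + h, p) \<in> D \<Longrightarrow> \<alpha> (g + h) p = \<alpha> g (\<alpha> h p)"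
proof -
  show "p \<in> topspace M \<Longrightarrow> (0, p) \<in> D \<and> \<alpha> 0 p = p"
    using lgs unfolding local_G_space_def by blast
  show "(g, p) \<in> D \<Longrightarrow> (- g, \<alpha> g p) \<in> D \<and> \<alpha> (- g) (\<alpha> g p) = p"
    using lgs D_subset unfolding local_G_space_def by (meson SigmaD2 subsetD)
  show "(h, p) \<in> D \<Longrightarrow> (g, \<alpha> h p) \<in> D \<Longrightarrow> (g + h, p) \<in> D \<Longrightarrow> \<alpha> (g + h) p = \<alpha> g (\<alpha> h p)"
    using lgs D_subset unfolding local_G_space_def by (meson SigmaD2 subsetD)
qed

lemma vol_radon: "radon_on M vol"
  using lvol by (simp add: local_vol_def)

lemma sets_vol: "sets vol = sets (borel_of M)"
  using vol_radon by (simp add: radon_on_def)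

lemma space_vol: "space vol = topspace M"
  using sets_eq_imp_space_eq[OF sets_vol] by (simp add: space_borel_of)

lemma open_sets_vol: "openin M U \<Longrightarrow> U \<in> sets vol"
  by (simp add: sets_vol openin_sets_borel_of)

definition Dom :: "'g \<Rightarrow> 'm set" where "Dom g = {p \<in> topspace M. (g, p) \<in> D}"

lemma mem_Dom: "p \<in> Dom g \<longleftrightarrow> (g, p) \<in> D"
  using D_subset by (auto simp: Dom_def)

lemma open_Dom: "openin M (Dom g)"
proof -
  have "continuous_map M (prod_topology euclidean M) (\<lambda>p. (g, p))"
    by (simp add: continuous_map_pairedI)
  then show ?thesis
    using open_D unfolding Dom_def continuous_map_def by blast
qed

lemma Dom_sets [measurable]: "Dom g \<in> sets vol"
  by (intro open_sets_vol open_Dom)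

lemma continuous_act: "continuous_map (subtopology M (Dom g)) M (\<alpha> g)"
proof -
  have "continuous_map (subtopology M (Dom g)) (subtopology (prod_topology euclidean M) D) (\<lambda>p. (g, p))"
    unfolding continuous_map_in_subtopology
    by (auto simp: mem_Dom intro!: continuous_map_pairedI continuous_map_from_subtopology)
  from continuous_map_compose[OF this continuous_\<alpha>] show ?thesis by (simp add: o_def)
qed

text \<open>Rewriting images as preimages under the inverse element makes images of Borel sets Borel
  and images of open sets open.\<close>

lemma act_image_eq: "A \<subseteq> Dom g \<Longrightarrow> \<alpha> g ` A = \<alpha> (- g) -` A \<inter> Dom (- g)"
proof (intro equalityI subsetI)
  assume A: "A \<subseteq> Dom g"
  { fix q assume "q \<in> \<alpha> g ` A"
    then show "q \<in> \<alpha> (- g) -` A \<inter> Dom (- g)" using A act_inverse by (auto simp: mem_Dom)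
  }
  { fix q assume q: "q \<in> \<alpha> (- g) -` A \<inter> Dom (- g)"
    then have "\<alpha> g (\<alpha> (- g) q) = q" using act_inverse[of "- g" q] by (simp add: mem_Dom)
    then show "q \<in> \<alpha> g ` A" using q by (metis IntD1 image_eqI vimageD)
  }
qed

lemma act_image_inverse: "A \<subseteq> Dom g \<Longrightarrow> \<alpha> (- g) ` \<alpha> g ` A = A"
  using act_inverse by (force simp: mem_Dom image_image)

lemma act_image_Dom: "A \<subseteq> Dom g \<Longrightarrow> \<alpha> g ` A \<subseteq> Dom (- g)"
  by (simp add: act_image_eq)

lemma measurable_act: "\<alpha> g \<in> measurable (restrict_space vol (Dom g)) vol"
  by (rule measurable_continuous_map_open[OF sets_vol sets_vol open_Dom continuous_act])

lemma act_image_sets: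
  assumes "A \<in> sets vol" "A \<subseteq> Dom g" shows "\<alpha> g ` A \<in> sets vol"
proof -
  have "\<alpha> (- g) -` A \<inter> space (restrict_space vol (Dom (- g))) \<in> sets (restrict_space vol (Dom (- g)))"
    using measurable_act assms(1) by (rule measurable_sets)
  moreover have "space (restrict_space vol (Dom (- g))) = Dom (- g)"
    by (auto simp: space_restrict_space space_vol Dom_def)
  ultimately show ?thesis
    using assms(2) by (auto simp: act_image_eq sets_restrict_space_iff)
qed

lemma act_image_open:
  assumes "openin M A" "A \<subseteq> Dom g" shows "openin M (\<alpha> g ` A)"
proof -
  have "openin (subtopology M (Dom (- g))) {x \<in> topspace (subtopology M (Dom (- g))). \<alpha> (- g) x \<in> A}"
    using continuous_act assms(1) by (auto simp: continuous_map_def)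
  moreover have "{x \<in> topspace (subtopology M (Dom (- g))). \<alpha> (- g) x \<in> A} = \<alpha> g ` A"
    using assms(2) by (auto simp: act_image_eq Dom_def)
  ultimately show ?thesis using open_Dom by (simp add: openin_open_subtopology)
qed

lemma open_orbit_domain: "p \<in> topspace M \<Longrightarrow> open {g. (g, p) \<in> D}"
proof -
  assume "p \<in> topspace M"
  then have "continuous_map euclidean (prod_topology euclidean M) (\<lambda>g::'g. (g, p))"
    by (simp add: continuous_map_pairedI)
  then show ?thesis
    using open_D unfolding continuous_map_def by (metis (no_types, lifting) UNIV_I mem_Collect_eq open_openin Collect_cong topspace_euclidean)
qed

text \<open>The neighbourhood from the fourth axiom of a partial action, bundled with the defining
  property of \<open>vol\<close>. The chart f_p is expressed by the orbit map g |-> g.p, whose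
  inverse it is: the set of all \<open>h\<close> in \<open>N\<close> with
  \<open>\<alpha> h p\<close> in \<open>K\<close> is f_p(K).\<close>

definition chart_domain :: "'m \<Rightarrow> 'g set \<Rightarrow> bool" where
  "chart_domain p N \<longleftrightarrow> open N \<and> 0 \<in> N \<and> N \<times> {p} \<subseteq> D \<and> inj_on (\<lambda>g. \<alpha> g p) N \<and>
     continuous_map (subtopology euclidean N) M (\<lambda>g. \<alpha> g p) \<and>
     (\<forall>S. open S \<longrightarrow> S \<subseteq> N \<longrightarrow> openin M ((\<lambda>g. \<alpha> g p) ` S)) \<and>
     (\<forall>K. K \<in> sets vol \<longrightarrow> K \<subseteq> (\<lambda>g. \<alpha> g p) ` N \<longrightarrow>
       {h \<in> N. \<alpha> h p \<in> K} \<in> sets borel \<and> emeasure vol K = emeasure Haar {h \<in> N. \<alpha> h p \<in> K})"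

lemma chart_domain_exists:
  assumes p: "p \<in> topspace M"
  shows "\<exists>N. chart_domain p N"
proof -
  let ?a = "\<lambda>g. \<alpha> g p"
  obtain N where N: "open N" "0 \<in> N" "N \<times> {p} \<subseteq> D" "openin M (?a ` N)" "p \<in> ?a ` N"
    "homeomorphic_map (subtopology euclidean N) (subtopology M (?a ` N)) ?a"
    using lgs p unfolding local_G_space_def by meson
  obtain f where f: "homeomorphic_maps (subtopology euclidean N) (subtopology M (?a ` N)) ?a f"
    using N(6) homeomorphic_map_maps by blast
  have fa: "f (?a h) = h" if "h \<in> N" for h
    using f that by (simp add: homeomorphic_maps_def)
  have fV: "f ` ?a ` N = N" using fa by (force simp: image_image)
  have cont: "continuous_map (subtopology euclidean N) M ?a"
    using homeomorphic_imp_continuous_map[OF N(6)] by (simp add: continuous_map_in_subtopology)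
  have hf: "homeomorphic_map (subtopology M (?a ` N)) (subtopology euclidean (f ` ?a ` N)) f"
    unfolding fV using f homeomorphic_maps_sym homeomorphic_map_maps by blast
  have chart: "emeasure vol K = emeasure Haar (f ` K)" if "K \<in> sets vol" "K \<subseteq> ?a ` N" for K
  proof -
    have "\<forall>g\<in>f ` ?a ` N. (g, p) \<in> D \<and> \<alpha> g p \<in> ?a ` N \<and> f (\<alpha> g p) = g"
      unfolding fV using N(3) fa by auto
    then show ?thesis
      using N(1,2) that
      by (intro lvol[unfolded local_vol_def, THEN conjunct2, rule_format, of p "?a ` N" f K] N(4,5) hf)
        (simp_all only: fV)
  qed
  have "chart_domain p N"
    unfolding chart_domain_def
  proof (intro conjI allI impI N(1-3) cont)
    show "inj_on ?a N" using fa by (rule inj_on_inverseI)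
    show "openin M (?a ` S)" if "open S" "S \<subseteq> N" for S
    proof -
      have "openin (subtopology euclidean N) S" using that N(1) by (simp add: openin_open_eq)
      then have "openin (subtopology M (?a ` N)) (?a ` S)"
        using homeomorphic_imp_open_map[OF N(6)] by (simp add: open_map_def)
      then show ?thesis using N(4) by (simp add: openin_open_subtopology)
    qed
    fix K assume K: "K \<in> sets vol" "K \<subseteq> ?a ` N"
    have "openin euclidean N" using N(1) by simp
    then have "?a \<in> measurable (restrict_space borel N) vol"
      by (intro measurable_continuous_map_open[OF _ sets_vol _ cont]) (simp_all add: sets_borel_of_euclidean)
    then have "?a -` K \<inter> space (restrict_space borel N) \<in> sets (restrict_space borel N)"
      using K(1) by (rule measurable_sets)
    moreover have "?a -` K \<inter> space (restrict_space borel N) = {h \<in> N. ?a h \<in> K}"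
      by (auto simp: space_restrict_space)
    ultimately have "{h \<in> N. ?a h \<in> K} \<in> sets borel"
      using N(1) by (simp add: sets_restrict_space_iff)
    moreover have "f ` K = {h \<in> N. ?a h \<in> K}"
    proof (intro equalityI subsetI)
      fix x assume "x \<in> f ` K"
      then obtain q where "q \<in> K" "x = f q" by blast
      moreover then obtain h where "h \<in> N" "q = ?a h" using K(2) by blast
      ultimately show "x \<in> {h \<in> N. ?a h \<in> K}" using fa by simp
    next
      fix x assume "x \<in> {h \<in> N. ?a h \<in> K}"
      then show "x \<in> f ` K" using fa[of x] by (metis (mono_tags, lifting) image_eqI mem_Collect_eq)
    qed
    ultimately show "{h \<in> N. ?a h \<in> K} \<in> sets borel" "emeasure vol K = emeasure Haar {h \<in> N. ?a h \<in> K}"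
      using chart[OF K] by simp_all
  qed
  then show ?thesis ..
qed

text \<open>In the charts at \<open>p\<close> and \<open>g.p\<close> the map \<open>\<alpha> g\<close> is the conjugation \<open>h \<mapsto> g + h - g\<close>.\<close>

lemma act_local_bound:
  assumes C: "\<And>E. E \<in> sets borel \<Longrightarrow> emeasure Haar ((\<lambda>x. g + x) ` E) \<le> C * emeasure Haar E"
    and gp: "(g, p) \<in> D"
  obtains V where "openin M V" "p \<in> V" "V \<subseteq> Dom g"
    "\<And>A. A \<in> sets vol \<Longrightarrow> A \<subseteq> V \<Longrightarrow> emeasure vol (\<alpha> g ` A) \<le> C * emeasure vol A"
proof -
  define q where "q = \<alpha> g p"
  have p: "p \<in> topspace M" using gp D_subset by auto
  have q: "q \<in> topspace M" using act_inverse[OF gp] D_subset by (auto simp: q_def)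
  obtain N where "chart_domain p N" using chart_domain_exists[OF p] ..
  then have N: "open N" "0 \<in> N" "N \<times> {p} \<subseteq> D" "inj_on (\<lambda>g. \<alpha> g p) N"
    "continuous_map (subtopology euclidean N) M (\<lambda>g. \<alpha> g p)"
    and Nop: "\<And>S. open S \<Longrightarrow> S \<subseteq> N \<Longrightarrow> openin M ((\<lambda>g. \<alpha> g p) ` S)"
    and Nvol: "\<And>K. K \<in> sets vol \<Longrightarrow> K \<subseteq> (\<lambda>g. \<alpha> g p) ` N \<Longrightarrow>
       {h \<in> N. \<alpha> h p \<in> K} \<in> sets borel \<and> emeasure vol K = emeasure Haar {h \<in> N. \<alpha> h p \<in> K}"
    unfolding chart_domain_def by simp_all
  obtain N' where "chart_domain q N'" using chart_domain_exists[OF q] ..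
  then have N': "open N'" "0 \<in> N'" "N' \<times> {q} \<subseteq> D" "inj_on (\<lambda>g. \<alpha> g q) N'"
    and Nvol': "\<And>K. K \<in> sets vol \<Longrightarrow> K \<subseteq> (\<lambda>g. \<alpha> g q) ` N' \<Longrightarrow>
       {h \<in> N'. \<alpha> h q \<in> K} \<in> sets borel \<and> emeasure vol K = emeasure Haar {h \<in> N'. \<alpha> h q \<in> K}"
    unfolding chart_domain_def by simp_all
  \<comment> \<open>The three conditions make g.(h.p), (g + h).p and (g + h - g).q all defined. The
    third axiom then applies twice to the same point: (g + h).p equals g.(h.p), and, since g + h =
    (g + h - g) + g, it also equals (g + h - g).q.\<close>
  define S where "S = {h \<in> N. \<alpha> h p \<in> Dom g} \<inter> (\<lambda>h. g + h) -` {k. (k, p) \<in> D} \<inter> (\<lambda>h. g + h - g) -` N'"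
  define V where "V = (\<lambda>h. \<alpha> h p) ` S"
  have "open {h \<in> N. \<alpha> h p \<in> Dom g}"
  proof -
    have "openin (subtopology euclidean N) {h \<in> topspace (subtopology euclidean N). \<alpha> h p \<in> Dom g}"
      using N(5) open_Dom by (auto simp: continuous_map_def)
    then show ?thesis using N(1) by (simp add: openin_open_eq)
  qed
  moreover have "open ((\<lambda>h. g + h) -` {k. (k, p) \<in> D})"
    by (intro open_vimage open_orbit_domain p continuous_group_intros)
  moreover have "open ((\<lambda>h. g + h - g) -` N')"
    by (intro open_vimage N' continuous_group_intros)
  ultimately have S: "open S" unfolding S_def by (intro open_Int)
  have SN: "S \<subseteq> N" by (auto simp: S_def)
  have S0: "0 \<in> S" using N N' gp act_zero[OF p] by (simp add: S_def mem_Dom)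
  have V: "openin M V" unfolding V_def by (rule Nop[OF S SN])
  have conj: "\<alpha> g (\<alpha> h p) = \<alpha> (g + h - g) q" if "h \<in> S" for h
  proof -
    have 1: "(h, p) \<in> D" "(g, \<alpha> h p) \<in> D" "(g + h, p) \<in> D" "g + h - g \<in> N'"
      using that N(3) by (auto simp: S_def mem_Dom)
    have "\<alpha> (g + h) p = \<alpha> g (\<alpha> h p)" using 1 by (intro act_add)
    moreover have "\<alpha> ((g + h - g) + g) p = \<alpha> (g + h - g) q"
      unfolding q_def using 1 N'(3) gp by (intro act_add) (auto simp: q_def)
    ultimately show ?thesis by simp
  qed
  show ?thesis
  proof (rule that[OF V])
    show "p \<in> V" unfolding V_def using S0 act_zero[OF p] by (metis image_eqI)
    show VD: "V \<subseteq> Dom g" by (auto simp: V_def S_def)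
    fix A assume A: "A \<in> sets vol" "A \<subseteq> V"
    have AD: "A \<subseteq> Dom g" using A VD by blast
    define E where "E = {h \<in> N. \<alpha> h p \<in> A}"
    have E: "E \<in> sets borel" "emeasure vol A = emeasure Haar E"
      using Nvol[OF A(1)] A(2) SN unfolding V_def E_def by auto
    have ES: "E \<subseteq> S"
    proof
      fix h assume h: "h \<in> E"
      then obtain h' where "h' \<in> S" "\<alpha> h p = \<alpha> h' p" using A(2) by (auto simp: E_def V_def)
      then show "h \<in> S" using N(4) h SN by (metis (no_types, lifting) E_def inj_onD mem_Collect_eq subsetD)
    qed
    have gA: "\<alpha> g ` A = (\<lambda>h. \<alpha> (g + h - g) q) ` E"
    proof -
      have "A = (\<lambda>h. \<alpha> h p) ` E" using A(2) SN by (auto simp: E_def V_def)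
      then have "\<alpha> g ` A = (\<lambda>h. \<alpha> g (\<alpha> h p)) ` E" by (simp add: image_image)
      also have "\<dots> = (\<lambda>h. \<alpha> (g + h - g) q) ` E"
        using conj ES by (intro image_cong) auto
      finally show ?thesis .
    qed
    have EN': "g + h - g \<in> N'" if "h \<in> E" for h
      using that ES by (auto simp: S_def)
    have eq: "{k \<in> N'. \<alpha> k q \<in> \<alpha> g ` A} = (\<lambda>x. x + - g) ` (\<lambda>x. g + x) ` E"
    proof (intro equalityI subsetI)
      fix k assume "k \<in> {k \<in> N'. \<alpha> k q \<in> \<alpha> g ` A}"
      then obtain h where h: "k \<in> N'" "h \<in> E" "\<alpha> k q = \<alpha> (g + h - g) q" unfolding gA by blast
      then have "k = g + h - g" using EN' N'(4) by (meson inj_onD)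
      then show "k \<in> (\<lambda>x. x + - g) ` (\<lambda>x. g + x) ` E" using h by (simp add: image_image)
    next
      fix k assume "k \<in> (\<lambda>x. x + - g) ` (\<lambda>x. g + x) ` E"
      then obtain h where "h \<in> E" "k = g + h - g" by auto
      then show "k \<in> {k \<in> N'. \<alpha> k q \<in> \<alpha> g ` A}" using EN' unfolding gA by blast
    qed
    have "\<alpha> g ` A \<subseteq> (\<lambda>k. \<alpha> k q) ` N'" unfolding gA using EN' by blast
    then have "emeasure vol (\<alpha> g ` A) = emeasure Haar {k \<in> N'. \<alpha> k q \<in> \<alpha> g ` A}"
      using Nvol'[OF act_image_sets[OF A(1) AD]] by blast
    \<comment> \<open>Of the conjugation only the left translation by \<open>g\<close> can change
      the measure; the right translation by \<open>- g\<close> preserves it.\<close>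
    also have "\<dots> = emeasure Haar ((\<lambda>x. g + x) ` E)"
      unfolding eq by (intro Haar_right_translate borel_left_translate E)
    also have "\<dots> \<le> C * emeasure vol A"
      using C[OF E(1)] E(2) by simp
    finally show "emeasure vol (\<alpha> g ` A) \<le> C * emeasure vol A" .
  qed
qed

text \<open>The local bound of \<open>act_local_bound\<close> is globalised in three stages: compact
  sets lie in finite unions of good neighbourhoods, open sets are exhausted by compact ones, and
  Borel sets are approximated by open ones from outside.\<close>

lemma act_bound:
  assumes C: "\<And>E. E \<in> sets borel \<Longrightarrow> emeasure Haar ((\<lambda>x. g + x) ` E) \<le> C * emeasure Haar E"
    and C': "0 < C" "C < \<infinity>"
    and A: "A \<in> sets vol" "A \<subseteq> Dom g"
  shows "emeasure vol (\<alpha> g ` A) \<le> C * emeasure vol A"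
proof -
  \<comment> \<open>The bound is demanded for all measurable subsets of \<open>B\<close>. A subset
    of a union can then be cut into disjoint pieces, so that finite unions keep the same constant
    \<open>C\<close>.\<close>
  define P where "P B \<longleftrightarrow> B \<in> sets vol \<and> B \<subseteq> Dom g \<and>
     (\<forall>A\<in>sets vol. A \<subseteq> B \<longrightarrow> emeasure vol (\<alpha> g ` A) \<le> C * emeasure vol A)" for B
  have P_Un: "P (B1 \<union> B2)" if "P B1" "P B2" for B1 B2
    unfolding P_def
  proof (intro conjI ballI impI)
    show "B1 \<union> B2 \<in> sets vol" "B1 \<union> B2 \<subseteq> Dom g" using that by (auto simp: P_def)
    fix A assume A: "A \<in> sets vol" "A \<subseteq> B1 \<union> B2"
    let ?A1 = "A \<inter> B1" and ?A2 = "A - B1"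
    have s: "?A1 \<in> sets vol" "?A2 \<in> sets vol" using A that by (auto simp: P_def)
    have d: "?A1 \<subseteq> Dom g" "?A2 \<subseteq> Dom g" using A that by (auto simp: P_def)
    have "\<alpha> g ` A = \<alpha> g ` ?A1 \<union> \<alpha> g ` ?A2" by auto
    then have "emeasure vol (\<alpha> g ` A) \<le> emeasure vol (\<alpha> g ` ?A1) + emeasure vol (\<alpha> g ` ?A2)"
      using emeasure_subadditive act_image_sets s d by metis
    also have "\<dots> \<le> C * emeasure vol ?A1 + C * emeasure vol ?A2"
      using that s A by (intro add_mono) (auto simp: P_def)
    also have "\<dots> = C * emeasure vol A"
    proof -
      have "emeasure vol ?A1 + emeasure vol ?A2 = emeasure vol (?A1 \<union> ?A2)"
        using s by (intro plus_emeasure) auto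
      also have "?A1 \<union> ?A2 = A" by auto
      finally show ?thesis by (simp flip: distrib_left)
    qed
    finally show "emeasure vol (\<alpha> g ` A) \<le> C * emeasure vol A" .
  qed
  have P_finite: "P (\<Union>F)" if "finite F" "\<And>V. V \<in> F \<Longrightarrow> P V" for F
    using that by (induction F rule: finite_induct) (auto intro!: P_Un simp: P_def[of "{}"])
  have comp: "emeasure vol (\<alpha> g ` K) \<le> C * emeasure vol K" if K: "compactin M K" "K \<subseteq> Dom g" for K
  proof -
    have "\<exists>V. openin M V \<and> P V \<and> p \<in> V" if "p \<in> K" for p
    proof -
      have "(g, p) \<in> D" using that K(2) mem_Dom by blast
      then obtain V where "openin M V" "p \<in> V" "V \<subseteq> Dom g"
        "\<And>A. A \<in> sets vol \<Longrightarrow> A \<subseteq> V \<Longrightarrow> emeasure vol (\<alpha> g ` A) \<le> C * emeasure vol A"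
        using act_local_bound[OF C] by metis
      then show ?thesis using open_sets_vol by (auto simp: P_def)
    qed
    then have "K \<subseteq> \<Union>{V. openin M V \<and> P V}" by blast
    then obtain F where F: "finite F" "F \<subseteq> {V. openin M V \<and> P V}" "K \<subseteq> \<Union>F"
      using compactinD[OF K(1), of "{V. openin M V \<and> P V}"] by auto
    then have "P (\<Union>F)" using P_finite by auto
    moreover have "K \<in> sets vol"
    proof -
      have "closedin M K" using compactin_imp_closedin Hausdorff K(1) by blast
      then have "K = space vol - (topspace M - K)" "openin M (topspace M - K)"
        using closedin_subset by (auto simp: space_vol openin_diff)
      then show ?thesis using open_sets_vol by (metis sets.compl_sets)
    qed
    ultimately show ?thesis using F(3) by (auto simp: P_def)
  qed
  have op: "emeasure vol (\<alpha> g ` U) \<le> C * emeasure vol U" if U: "openin M U" "U \<subseteq> Dom g" for U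
  proof -
    have "emeasure vol (\<alpha> g ` U) = (SUP K\<in>{K. compactin M K \<and> K \<subseteq> \<alpha> g ` U}. emeasure vol K)"
      using vol_radon act_image_open[OF U] by (simp add: radon_on_def)
    also have "\<dots> \<le> C * emeasure vol U"
    proof (rule SUP_least)
      fix K assume "K \<in> {K. compactin M K \<and> K \<subseteq> \<alpha> g ` U}"
      then have K: "compactin M K" "K \<subseteq> \<alpha> g ` U" by auto
      have KD: "K \<subseteq> Dom (- g)" using K(2) act_image_Dom[OF U(2)] by blast
      \<comment> \<open>Inner regularity supplies compact subsets of the image of \<open>U\<close>;
        pulling them back by \<open>- g\<close> yields compact subsets of \<open>U\<close>, to which
        the previous stage applies.\<close>
      define L where "L = \<alpha> (- g) ` K"
      have "compactin (subtopology M (Dom (- g))) K"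
        using K KD by (simp add: compactin_subtopology)
      then have L: "compactin M L" unfolding L_def using continuous_act by (rule image_compactin)
      have LU: "L \<subseteq> U"
        unfolding L_def using K(2) act_image_inverse[OF U(2)] by blast
      have "K = \<alpha> g ` L" unfolding L_def using act_image_inverse[OF KD] by simp
      then have "emeasure vol K \<le> C * emeasure vol L" using comp[OF L] LU U by auto
      also have "\<dots> \<le> C * emeasure vol U"
        using LU U open_sets_vol by (intro mult_left_mono emeasure_mono) auto
      finally show "emeasure vol K \<le> C * emeasure vol U" .
    qed
    finally show ?thesis .
  qed
  have "emeasure vol (\<alpha> g ` A) \<le> C * emeasure vol U" if U: "openin M U" "A \<subseteq> U" for U
  proof -
    \<comment> \<open>An open set provided by outer regularity may leave the domain of
      \<open>g\<close>, so it is first intersected with the open set \<open>Dom g\<close>.\<close>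
    have UD: "openin M (U \<inter> Dom g)" using U open_Dom by blast
    have "emeasure vol (\<alpha> g ` A) \<le> emeasure vol (\<alpha> g ` (U \<inter> Dom g))"
      using A U UD open_sets_vol act_image_sets by (intro emeasure_mono) auto
    also have "\<dots> \<le> C * emeasure vol (U \<inter> Dom g)" using op UD by auto
    also have "\<dots> \<le> C * emeasure vol U"
      using U open_sets_vol by (intro mult_left_mono emeasure_mono) auto
    finally show ?thesis .
  qed
  then have "emeasure vol (\<alpha> g ` A) / C \<le> (INF U\<in>{U. openin M U \<and> A \<subseteq> U}. emeasure vol U)"
    using C' by (intro INF_greatest divide_le_posI_ennreal) auto
  also have "\<dots> = emeasure vol A"
    using vol_radon A(1) by (simp add: radon_on_def)
  finally have "C * (emeasure vol (\<alpha> g ` A) / C) \<le> C * emeasure vol A"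
    by (rule mult_left_mono) simp
  then show ?thesis
    using C' by (simp add: ennreal_times_divide mult.commute[of C] ennreal_mult_divide_eq)
qed

text \<open>The image of \<open>vol\<close> on \<open>Dom g\<close> under \<open>\<alpha> g\<close>
  gives to \<open>B\<close> the volume of \<open>B \<inter> Dom (- g)\<close> moved by
  \<open>- g\<close>. This is why the hypothesis concerns left translation by
  \<open>- g\<close>.\<close>

lemma nn_integral_act_le:
  assumes C: "\<And>E. E \<in> sets borel \<Longrightarrow> emeasure Haar ((\<lambda>x. - g + x) ` E) \<le> C * emeasure Haar E"
    and C': "0 < C" "C < \<infinity>"
    and f: "f \<in> borel_measurable vol"
  shows "(\<integral>\<^sup>+p. indicator (Dom g) p * f (\<alpha> g p) \<partial>vol) \<le> C * (\<integral>\<^sup>+p. f p \<partial>vol)"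
proof -
  let ?R = "restrict_space vol (Dom g)"
  let ?N = "distr ?R vol (\<alpha> g)"
  have sp: "space ?R = Dom g" by (auto simp: space_restrict_space space_vol Dom_def)
  have "emeasure ?N B \<le> C * emeasure vol B" if B: "B \<in> sets vol" for B
  proof -
    have eq: "\<alpha> g -` B \<inter> Dom g = \<alpha> (- g) ` (B \<inter> Dom (- g))"
      using act_inverse[of g] act_inverse[of "- g"] by (subst act_image_eq) (auto simp: mem_Dom)
    have "emeasure ?N B = emeasure vol (\<alpha> (- g) ` (B \<inter> Dom (- g)))"
      using B measurable_act by (simp add: emeasure_distr sp emeasure_restrict_space eq[symmetric])
    also have "\<dots> \<le> C * emeasure vol (B \<inter> Dom (- g))"
      using B by (intro act_bound C C') auto
    also have "\<dots> \<le> C * emeasure vol B"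
      using B by (intro mult_left_mono emeasure_mono) auto
    finally show ?thesis .
  qed
  then have le: "?N \<le> scale_measure C vol"
    by (subst le_measure) (auto simp: le_fun_def)
  have "(\<integral>\<^sup>+p. indicator (Dom g) p * f (\<alpha> g p) \<partial>vol) = (\<integral>\<^sup>+p. f (\<alpha> g p) \<partial>?R)"
    by (subst nn_integral_restrict_space) (auto simp: mult.commute)
  also have "\<dots> = (\<integral>\<^sup>+p. f p \<partial>?N)"
    using measurable_act f by (simp add: nn_integral_distr)
  also have "\<dots> \<le> (\<integral>\<^sup>+p. f p \<partial>scale_measure C vol)"
    by (intro nn_integral_mono_measure le) simp
  also have "\<dots> = C * (\<integral>\<^sup>+p. f p \<partial>vol)"
    using f by (rule nn_integral_scale_measure)
  finally show ?thesis .
qed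

end

section \<open>Dynamically generating pseudometrics\<close>

lemma good_pseudometricD:
  assumes "good_pseudometric act \<rho>"
  shows "continuous_on UNIV (\<lambda>z. \<rho> (fst z) (snd z))" "\<rho> x x = 0" "\<rho> x y = \<rho> y x"
    "\<rho> x z \<le> \<rho> x y + \<rho> y z" "0 \<le> \<rho> x y" "\<rho> x y \<le> 1" "x \<noteq> y \<Longrightarrow> \<exists>g. \<rho> (act g x) (act g y) > 0"
  using assms unfolding good_pseudometric_def by auto

lemma good_pseudometric_continuous:
  assumes "good_pseudometric act \<rho>" "continuous_on S f" "continuous_on S g"
  shows "continuous_on S (\<lambda>x. \<rho> (f x) (g x))"
  using continuous_on_compose2[OF good_pseudometricD(1)[OF assms(1)] continuous_on_Pair[OF assms(2,3)]] by simp

lemma continuous_on_act: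
  assumes "G_system act" "continuous_on S f"
  shows "continuous_on S (\<lambda>z. act g (f z))"
proof -
  have "continuous_on UNIV (\<lambda>z. act (fst z) (snd z))" using assms(1) by (simp add: G_system_def)
  from continuous_on_compose2[OF this continuous_on_Pair[OF continuous_on_const assms(2)]]
  show ?thesis by simp
qed

lemma good_pseudometric_separable:
  fixes \<rho> :: "'x::topological_space \<Rightarrow> 'x \<Rightarrow> real"
  assumes comp: "compact (UNIV :: 'x set)" and \<rho>: "good_pseudometric act \<rho>"
  shows "\<exists>E. countable E \<and> E \<noteq> {} \<and> (\<forall>y. \<forall>r>0. \<exists>d\<in>E. \<rho> y d < r)"
proof -
  have "\<exists>F. finite F \<and> (\<forall>y. \<exists>d\<in>F. \<rho> y d < 1 / real (Suc n))" for n
  proof -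
    define T where "T d = {y. \<rho> y d < 1 / real (Suc n)}" for d
    have T_open: "open (T d)" for d
      unfolding T_def
      by (intro open_Collect_less good_pseudometric_continuous[OF \<rho>] continuous_intros)
    have T_mem: "y \<in> T y" for y using good_pseudometricD(2)[OF \<rho>] by (simp add: T_def)
    obtain F where "finite F" "UNIV \<subseteq> (\<Union>d\<in>F. T d)"
      by (rule compactE_image[OF comp, of UNIV T]) (auto intro: T_open T_mem)
    then show ?thesis by (intro exI[of _ F]) (auto simp: T_def)
  qed
  then obtain F where F: "\<And>n. finite (F n)" "\<And>n y. \<exists>d\<in>F n. \<rho> y d < 1 / real (Suc n)"
    by metis
  have dense: "\<exists>d\<in>\<Union>(range F). \<rho> y d < r" if "r > 0" for y r
  proof -
    obtain n where "1 / real (Suc n) < r" using \<open>r > 0\<close> nat_approx_posE by blast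
    moreover obtain d where "d \<in> F n" "\<rho> y d < 1 / real (Suc n)" using F(2) by blast
    ultimately show ?thesis by (intro bexI[of _ d]) auto
  qed
  moreover have "countable (\<Union>(range F))" using F(1) by (intro countable_UN) (auto intro: countable_finite)
  moreover have "\<Union>(range F) \<noteq> {}" using dense[of 1] by fastforce
  ultimately show ?thesis by blast
qed

text \<open>Without second countability of the type, continuity of \<open>\<rho>\<close> on the
  product does not give measurability for the product sigma-algebra. Instead
  \<open>\<rho> x y\<close> is written as the infimum of \<open>\<rho> x d + \<rho> y d\<close> over
  a countable \<open>\<rho>\<close>-dense set, where each summand depends on one variable.\<close>

lemma good_pseudometric_measurable:
  fixes \<rho> :: "'x::topological_space \<Rightarrow> 'x \<Rightarrow> real"
  assumes comp: "compact (UNIV :: 'x set)" and \<rho>: "good_pseudometric act \<rho>"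
    and f: "f \<in> measurable N borel" and g: "g \<in> measurable N borel"
  shows "(\<lambda>p. \<rho> (f p) (g p)) \<in> borel_measurable N"
proof -
  obtain E where E: "countable E" "E \<noteq> {}" "\<And>y r. r > 0 \<Longrightarrow> \<exists>d\<in>E. \<rho> y d < r"
    using good_pseudometric_separable[OF comp \<rho>] by blast
  note \<rho>D = good_pseudometricD[OF \<rho>]
  have bdd: "bdd_below ((\<lambda>d. \<rho> x d + \<rho> y d) ` E)" for x y
    by (rule bdd_belowI2[of _ 0]) (simp add: \<rho>D)
  have eq: "\<rho> x y = (INF d\<in>E. \<rho> x d + \<rho> y d)" for x y
  proof (rule antisym)
    show "\<rho> x y \<le> (INF d\<in>E. \<rho> x d + \<rho> y d)"
      using E(2) by (rule cINF_greatest) (metis \<rho>D(3,4))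
    show "(INF d\<in>E. \<rho> x d + \<rho> y d) \<le> \<rho> x y"
    proof (rule field_le_epsilon)
      fix e :: real assume "e > 0"
      then obtain d where d: "d \<in> E" "\<rho> y d < e / 2" using E(3)[of "e/2" y] by auto
      have "(INF d\<in>E. \<rho> x d + \<rho> y d) \<le> \<rho> x d + \<rho> y d"
        using bdd d(1) by (rule cINF_lower)
      also have "\<dots> \<le> \<rho> x y + e" using \<rho>D(4)[of x d y] d(2) by simp
      finally show "(INF d\<in>E. \<rho> x d + \<rho> y d) \<le> \<rho> x y + e" .
    qed
  qed
  have m: "(\<lambda>x. \<rho> x d) \<in> borel_measurable borel" for d
    by (intro borel_measurable_continuous_onI good_pseudometric_continuous[OF \<rho>] continuous_intros)
  have "(\<lambda>p. INF d\<in>E. \<rho> (f p) d + \<rho> (g p) d) \<in> borel_measurable N"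
    using E(1,2) bdd
    by (intro borel_measurable_cINF borel_measurable_add measurable_compose[OF f m] measurable_compose[OF g m])
  then show ?thesis by (simp add: eq[symmetric])
qed

text \<open>Compactness makes dynamical generation quantitative: the sum over a finite set of translates
  of \<open>\<rho>2\<close> is bounded below on the compact set \<open>\<rho>1 \<ge> \<eta>\<close>, which is disjoint from the diagonal.\<close>

lemma good_pseudometric_dominated:
  fixes act :: "'g::{group_add,topological_space} \<Rightarrow> 'x::metric_space \<Rightarrow> 'x"
  assumes sys: "G_system act" and r1: "good_pseudometric act \<rho>1" and r2: "good_pseudometric act \<rho>2"
    and "\<eta> > 0"
  shows "\<exists>F B. finite F \<and> 0 \<le> B \<and> (\<forall>x y. \<rho>1 x y \<le> \<eta> + B * (\<Sum>g\<in>F. \<rho>2 (act g x) (act g y)))"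
proof -
  define K where "K = {z. \<eta> \<le> \<rho>1 (fst z) (snd z)}"
  define T where "T g = {z. 0 < \<rho>2 (act g (fst z)) (act g (snd z))}" for g
  have cont: "continuous_on UNIV (\<lambda>z. \<rho>2 (act g (fst z)) (act g (snd z)))" for g
    by (intro good_pseudometric_continuous[OF r2] continuous_on_act[OF sys] continuous_on_fst continuous_on_snd continuous_on_id)
  have "closed K" unfolding K_def
    by (intro closed_Collect_le continuous_on_const good_pseudometricD[OF r1])
  moreover have "compact (UNIV :: ('x \<times> 'x) set)"
    using compact_Times[of "UNIV::'x set" "UNIV::'x set"] sys by (simp add: G_system_def)
  ultimately have K: "compact K" using compact_Int_closed by fastforce
  have "open (T g)" for g
    unfolding T_def by (intro open_Collect_less continuous_on_const cont)
  moreover have "K \<subseteq> (\<Union>g\<in>UNIV. T g)"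
  proof
    fix z assume z: "z \<in> K"
    then have "fst z \<noteq> snd z"
      using \<open>\<eta> > 0\<close> good_pseudometricD(2)[OF r1] by (auto simp: K_def)
    then show "z \<in> (\<Union>g\<in>UNIV. T g)"
      using good_pseudometricD(7)[OF r2] by (auto simp: T_def)
  qed
  ultimately obtain F where F: "finite F" "K \<subseteq> (\<Union>g\<in>F. T g)"
    by (meson compactE_image[OF K])
  define s where "s z = (\<Sum>g\<in>F. \<rho>2 (act g (fst z)) (act g (snd z)))" for z
  have s0: "0 \<le> s z" for z
    unfolding s_def by (intro sum_nonneg good_pseudometricD[OF r2])
  have spos: "0 < s z" if zK: "z \<in> K" for z
  proof -
    obtain g where "g \<in> F" "z \<in> T g" using F(2) zK by blast
    then show ?thesis
      unfolding s_def T_def using F(1) good_pseudometricD(5)[OF r2] by (intro sum_pos2[of F g]) auto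
  qed
  \<comment> \<open>As \<open>\<rho>1\<close> is at most 1, this suffices on \<open>K\<close>; off
    \<open>K\<close> the term \<open>\<eta>\<close> alone suffices. \<open>B\<close> is the
    reciprocal of the minimum of \<open>s\<close> on \<open>K\<close>.\<close>
  have "\<exists>B\<ge>0. \<forall>z\<in>K. 1 \<le> B * s z"
  proof (cases "K = {}")
    case False
    have "continuous_on K s"
      unfolding s_def by (intro continuous_on_sum continuous_on_subset[OF cont]) auto
    then obtain z0 where z0: "z0 \<in> K" "\<And>z. z \<in> K \<Longrightarrow> s z0 \<le> s z"
      using continuous_attains_inf[OF K False] by blast
    then show ?thesis
      using spos by (intro exI[of _ "1 / s z0"]) (auto simp: less_imp_le field_simps)
  qed auto
  then obtain B where B: "B \<ge> 0" "\<And>z. z \<in> K \<Longrightarrow> 1 \<le> B * s z" by blast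
  have "\<rho>1 x y \<le> \<eta> + B * s (x, y)" for x y
  proof (cases "(x, y) \<in> K")
    case True
    then show ?thesis using B(2)[OF True] good_pseudometricD(6)[OF r1, of x y] \<open>\<eta> > 0\<close> by linarith
  next
    case False
    have "0 \<le> B * s (x, y)" using B(1) s0 by simp
    then show ?thesis using False by (simp add: K_def)
  qed
  then show ?thesis using F(1) B(1) unfolding s_def fst_conv snd_conv by blast
qed

text \<open>Here and in the next lemma \<open>b\<close> is the total volume, which may be 0: the
  hypothesis then forces \<open>a = 0\<close>, and 0 / 0 is 0.\<close>

lemma ennreal_divide_le: "a \<le> c * b \<Longrightarrow> a / b \<le> (c :: ennreal)"
  by (cases "b = 0") (auto intro!: divide_le_posI_ennreal simp: mult.commute zero_less_iff_neq_zero)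

lemma ennreal_le_mult_of_divide_le:
  assumes "a / b \<le> ennreal c" "b < \<infinity>" shows "a \<le> ennreal c * b"
proof (cases "b = 0")
  case True then show ?thesis using assms(1) by (auto split: if_splits simp: top_unique)
next
  case False
  have "a = a / b * b" using False assms(2)
    by (simp add: ennreal_divide_times ennreal_times_divide ennreal_mult_divide_eq)
  then show ?thesis using assms(1) by (metis mult_right_mono zero_le)
qed

section \<open>Transfer between two pseudometrics\<close>

locale sofic_space = local_space Haar M D \<alpha> vol
  for Haar :: "'g::{group_add,t2_space,second_countable_topology} measure"
    and M :: "'m topology" and D :: "('g \<times> 'm) set" and \<alpha> :: "'g \<Rightarrow> 'm \<Rightarrow> 'm" and vol :: "'m measure" +
  fixes act :: "'g \<Rightarrow> 'x::metric_space \<Rightarrow> 'x"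
  assumes finite_vol: "emeasure vol (space vol) < \<infinity>" and sys: "G_system act"
begin

lemma compact_UNIV: "compact (UNIV :: 'x set)"
  using sys by (simp add: G_system_def)

lemma measurable_act_comp:
  assumes "\<phi> \<in> measurable N borel" shows "(\<lambda>p. act g (\<phi> p)) \<in> measurable N borel"
  by (intro measurable_compose[OF assms] borel_measurable_continuous_onI continuous_on_act[OF sys] continuous_on_id)

lemma measurable_pseudometric_Dom:
  assumes \<rho>: "good_pseudometric act \<rho>"
    and f: "f \<in> measurable (restrict_space vol (Dom g)) borel"
    and h: "h \<in> measurable (restrict_space vol (Dom g)) borel"
  shows "(\<lambda>p. indicator (Dom g) p * ennreal (\<rho> (f p) (h p))) \<in> borel_measurable vol"
proof -
  have "(\<lambda>p. ennreal (\<rho> (f p) (h p))) \<in> borel_measurable (restrict_space vol (Dom g))"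
    by (intro measurable_compose[OF good_pseudometric_measurable[OF compact_UNIV \<rho> f h]]) simp
  then show ?thesis
    by (subst (asm) borel_measurable_restrict_space_iff_ennreal) (auto simp: mult.commute)
qed

lemma measurable_restrict_Dom: "\<phi> \<in> measurable vol borel \<Longrightarrow> \<phi> \<in> measurable (restrict_space vol (Dom g)) borel"
  by (rule measurable_restrict_space1)

lemma measurable_comp_action: "\<phi> \<in> measurable vol borel \<Longrightarrow> (\<lambda>p. \<phi> (\<alpha> g p)) \<in> measurable (restrict_space vol (Dom g)) borel"
  by (rule measurable_compose[OF measurable_act])

text \<open>The failure of equivariance at \<open>g\<close>, set to 0 outside \<open>Dom g\<close>;
  the volume of that complement is accounted for separately, as in \<open>rhoM\<close>.\<close>

definition defect :: "('x \<Rightarrow> 'x \<Rightarrow> real) \<Rightarrow> 'g \<Rightarrow> ('m \<Rightarrow> 'x) \<Rightarrow> 'm \<Rightarrow> ennreal" where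
  "defect \<rho> g \<phi> p = indicator (Dom g) p * ennreal (\<rho> (\<phi> (\<alpha> g p)) (act g (\<phi> p)))"

lemma measurable_defect:
  assumes "good_pseudometric act \<rho>" "\<phi> \<in> measurable vol borel"
  shows "defect \<rho> g \<phi> \<in> borel_measurable vol"
  unfolding defect_def[abs_def]
  by (intro measurable_pseudometric_Dom[OF assms(1)] measurable_comp_action measurable_act_comp
      measurable_restrict_Dom assms)

lemma Map_approxD:
  assumes "\<phi> \<in> Map_approx act D \<alpha> vol \<rho> U \<delta>" "g \<in> U"
  shows "\<phi> \<in> measurable vol borel"
    "emeasure vol (space vol - Dom g) + (\<integral>\<^sup>+p. defect \<rho> g \<phi> p \<partial>vol) \<le> ennreal \<delta> * emeasure vol (space vol)"
proof -
  show "\<phi> \<in> measurable vol borel" using assms by (simp add: Map_approx_def)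
  have "{p \<in> space vol. (g, p) \<in> D} = Dom g" by (auto simp: Dom_def space_vol)
  then have "rhoM vol \<rho> (Dom g) (\<lambda>p. \<phi> (\<alpha> g p)) (\<lambda>p. act g (\<phi> p)) \<le> ennreal \<delta>"
    using assms unfolding Map_approx_def by (metis (mono_tags, lifting) less_imp_le mem_Collect_eq)
  then show "emeasure vol (space vol - Dom g) + (\<integral>\<^sup>+p. defect \<rho> g \<phi> p \<partial>vol) \<le> ennreal \<delta> * emeasure vol (space vol)"
    unfolding rhoM_def defect_def using finite_vol by (intro ennreal_le_mult_of_divide_le)
qed

text \<open>Used contrapositively. For each \<open>g\<close> in \<open>F\<close> the points g
  \<phi>(p) and g \<psi>(p) are joined through \<phi>(g.p) and \<psi>(g.p). The two outer distances
  are defects, and the middle one is the \<open>\<rho>2\<close>-distance of \<phi> and \<psi> at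
  g.p, which a change of variables bounds by C times their mean distance. Each \<open>g\<close> thus
  contributes at most \<open>2 * \<delta> + C * \<epsilon>'\<close>.\<close>

lemma separation_transfer:
  assumes r1: "good_pseudometric act \<rho>1" and r2: "good_pseudometric act \<rho>2"
    and F: "finite F" "F \<subseteq> U" and B: "0 \<le> B"
    and dom: "\<And>x y. \<rho>1 x y \<le> \<eta> + B * (\<Sum>g\<in>F. \<rho>2 (act g x) (act g y))"
    and C: "0 < C" "\<And>g E. g \<in> F \<Longrightarrow> E \<in> sets borel \<Longrightarrow>
      emeasure Haar ((\<lambda>x. - g + x) ` E) \<le> ennreal C * emeasure Haar E"
    and \<phi>: "\<phi> \<in> Map_approx act D \<alpha> vol \<rho>2 U \<delta>" and \<psi>: "\<psi> \<in> Map_approx act D \<alpha> vol \<rho>2 U \<delta>"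
    and close: "rhoM vol \<rho>2 (space vol) \<phi> \<psi> \<le> ennreal \<epsilon>'"
    and nonneg: "0 \<le> \<eta>" "0 \<le> \<delta>" "0 \<le> \<epsilon>'"
    and le: "\<eta> + B * (real (card F) * (2 * \<delta> + C * \<epsilon>')) \<le> \<epsilon>"
  shows "rhoM vol \<rho>1 (space vol) \<phi> \<psi> \<le> ennreal \<epsilon>"
proof -
  let ?v = "emeasure vol (space vol)"
  have mea: "\<phi> \<in> measurable vol borel" "\<psi> \<in> measurable vol borel"
    using \<phi> \<psi> by (auto simp: Map_approx_def)
  have rm: "(\<lambda>p. ennreal (\<rho>2 (f p) (h p))) \<in> borel_measurable vol"
    if "f \<in> measurable vol borel" "h \<in> measurable vol borel" for f h
    using good_pseudometric_measurable[OF compact_UNIV r2 that] by simp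
  note mea' = measurable_act_comp[OF mea(1)] measurable_act_comp[OF mea(2)]
  have J: "(\<integral>\<^sup>+p. ennreal (\<rho>2 (\<phi> p) (\<psi> p)) \<partial>vol) \<le> ennreal \<epsilon>' * ?v"
  proof -
    have "(\<integral>\<^sup>+p. ennreal (\<rho>2 (\<phi> p) (\<psi> p)) \<partial>vol) = (\<integral>\<^sup>+p. indicator (space vol) p * ennreal (\<rho>2 (\<phi> p) (\<psi> p)) \<partial>vol)"
      by (intro nn_integral_cong) simp
    then show ?thesis
      using close finite_vol unfolding rhoM_def by (intro ennreal_le_mult_of_divide_le) simp_all
  qed
  have step: "(\<integral>\<^sup>+p. ennreal (\<rho>2 (act g (\<phi> p)) (act g (\<psi> p))) \<partial>vol) \<le> ennreal (2 * \<delta> + C * \<epsilon>') * ?v"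
    if g: "g \<in> F" for g
  proof -
    have gU: "g \<in> U" using g F by auto
    define t where "t p = indicator (Dom g) p * ennreal (\<rho>2 (\<phi> (\<alpha> g p)) (\<psi> (\<alpha> g p)))" for p
    have tm: "t \<in> borel_measurable vol"
      unfolding t_def by (intro measurable_pseudometric_Dom[OF r2] measurable_comp_action mea)
    note dm = measurable_defect[OF r2 mea(1), of g] measurable_defect[OF r2 mea(2), of g]
    have "(\<integral>\<^sup>+p. ennreal (\<rho>2 (act g (\<phi> p)) (act g (\<psi> p))) \<partial>vol)
      \<le> (\<integral>\<^sup>+p. indicator (space vol - Dom g) p + defect \<rho>2 g \<phi> p + t p + defect \<rho>2 g \<psi> p \<partial>vol)"
    proof (rule nn_integral_mono)
      fix p assume p: "p \<in> space vol"
      show "ennreal (\<rho>2 (act g (\<phi> p)) (act g (\<psi> p))) \<le>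
        indicator (space vol - Dom g) p + defect \<rho>2 g \<phi> p + t p + defect \<rho>2 g \<psi> p"
      proof (cases "p \<in> Dom g")
        case True
        have "\<rho>2 (act g (\<phi> p)) (act g (\<psi> p)) \<le> \<rho>2 (\<phi> (\<alpha> g p)) (act g (\<phi> p)) +
           \<rho>2 (\<phi> (\<alpha> g p)) (\<psi> (\<alpha> g p)) + \<rho>2 (\<psi> (\<alpha> g p)) (act g (\<psi> p))"
          using good_pseudometricD(4)[OF r2, of "act g (\<phi> p)" "act g (\<psi> p)" "\<phi> (\<alpha> g p)"]
            good_pseudometricD(4)[OF r2, of "\<phi> (\<alpha> g p)" "act g (\<psi> p)" "\<psi> (\<alpha> g p)"]
            good_pseudometricD(3)[OF r2, of "act g (\<phi> p)" "\<phi> (\<alpha> g p)"] by linarith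
        then have "ennreal (\<rho>2 (act g (\<phi> p)) (act g (\<psi> p))) \<le> ennreal (\<rho>2 (\<phi> (\<alpha> g p)) (act g (\<phi> p)) +
           \<rho>2 (\<phi> (\<alpha> g p)) (\<psi> (\<alpha> g p)) + \<rho>2 (\<psi> (\<alpha> g p)) (act g (\<psi> p)))"
          by (rule ennreal_leI)
        also have "\<dots> = indicator (space vol - Dom g) p + defect \<rho>2 g \<phi> p + t p + defect \<rho>2 g \<psi> p"
          using True good_pseudometricD(5)[OF r2] by (simp add: defect_def t_def ennreal_plus)
        finally show ?thesis .
      next
        case False
        have "ennreal (\<rho>2 (act g (\<phi> p)) (act g (\<psi> p))) \<le> 1"
          using good_pseudometricD(6)[OF r2] by simp
        then show ?thesis using False p by (simp add: defect_def t_def)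
      qed
    qed
    also have "\<dots> = emeasure vol (space vol - Dom g) + (\<integral>\<^sup>+p. defect \<rho>2 g \<phi> p \<partial>vol) +
       (\<integral>\<^sup>+p. t p \<partial>vol) + (\<integral>\<^sup>+p. defect \<rho>2 g \<psi> p \<partial>vol)"
      using dm tm by (simp add: nn_integral_add)
    \<comment> \<open>The complement of \<open>Dom g\<close> is paid for once, from the budget of
      \<open>\<phi>\<close>; only the defect is taken from that of \<open>\<psi>\<close>.\<close>
    also have "\<dots> \<le> ennreal \<delta> * ?v + ennreal C * (ennreal \<epsilon>' * ?v) + ennreal \<delta> * ?v"
    proof (intro add_mono)
      show "emeasure vol (space vol - Dom g) + (\<integral>\<^sup>+p. defect \<rho>2 g \<phi> p \<partial>vol) \<le> ennreal \<delta> * ?v"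
        by (rule Map_approxD[OF \<phi> gU])
      show "(\<integral>\<^sup>+p. defect \<rho>2 g \<psi> p \<partial>vol) \<le> ennreal \<delta> * ?v"
        using Map_approxD(2)[OF \<psi> gU] by (rule order_trans[rotated]) simp
      have "(\<integral>\<^sup>+p. t p \<partial>vol) \<le> ennreal C * (\<integral>\<^sup>+p. ennreal (\<rho>2 (\<phi> p) (\<psi> p)) \<partial>vol)"
        unfolding t_def using C(1) g by (intro nn_integral_act_le C(2) rm mea) auto
      also have "\<dots> \<le> ennreal C * (ennreal \<epsilon>' * ?v)" by (intro mult_left_mono J) simp
      finally show "(\<integral>\<^sup>+p. t p \<partial>vol) \<le> ennreal C * (ennreal \<epsilon>' * ?v)" .
    qed
    also have "\<dots> = ennreal (2 * \<delta> + C * \<epsilon>') * ?v"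
      using nonneg C(1) finite_vol
      by (cases ?v) (simp_all add: ennreal_mult[symmetric] ennreal_plus[symmetric] algebra_simps del: ennreal_plus)
    finally show ?thesis .
  qed
  have "(\<integral>\<^sup>+p. indicator (space vol) p * ennreal (\<rho>1 (\<phi> p) (\<psi> p)) \<partial>vol) \<le>
      (\<integral>\<^sup>+p. ennreal \<eta> + ennreal B * (\<Sum>g\<in>F. ennreal (\<rho>2 (act g (\<phi> p)) (act g (\<psi> p)))) \<partial>vol)"
  proof (rule nn_integral_mono)
    fix p assume "p \<in> space vol"
    have "ennreal (\<rho>1 (\<phi> p) (\<psi> p)) \<le> ennreal (\<eta> + B * (\<Sum>g\<in>F. \<rho>2 (act g (\<phi> p)) (act g (\<psi> p))))"
      using dom by (rule ennreal_leI)
    also have "\<dots> = ennreal \<eta> + ennreal B * (\<Sum>g\<in>F. ennreal (\<rho>2 (act g (\<phi> p)) (act g (\<psi> p))))"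
      using B nonneg good_pseudometricD(5)[OF r2] by (simp add: ennreal_plus ennreal_mult sum_nonneg)
    finally show "indicator (space vol) p * ennreal (\<rho>1 (\<phi> p) (\<psi> p)) \<le>
       ennreal \<eta> + ennreal B * (\<Sum>g\<in>F. ennreal (\<rho>2 (act g (\<phi> p)) (act g (\<psi> p))))"
      using \<open>p \<in> space vol\<close> by simp
  qed
  also have "\<dots> = ennreal \<eta> * ?v + ennreal B * (\<Sum>g\<in>F. \<integral>\<^sup>+p. ennreal (\<rho>2 (act g (\<phi> p)) (act g (\<psi> p))) \<partial>vol)"
    using rm[OF mea'] by (simp add: nn_integral_add nn_integral_cmult nn_integral_sum)
  also have "\<dots> \<le> ennreal \<eta> * ?v + ennreal B * (\<Sum>g\<in>F. ennreal (2 * \<delta> + C * \<epsilon>') * ?v)"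
    by (intro add_left_mono mult_left_mono sum_mono step) simp_all
  also have "\<dots> = ennreal (\<eta> + B * (real (card F) * (2 * \<delta> + C * \<epsilon>'))) * ?v"
    using nonneg C(1) B by (simp add: ennreal_plus ennreal_mult distrib_right mult.assoc ennreal_of_nat_eq_real_of_nat)
  also have "\<dots> \<le> ennreal \<epsilon> * ?v"
    using le by (intro mult_right_mono ennreal_leI) simp_all
  finally show ?thesis
    unfolding rhoM_def by (intro ennreal_divide_le) simp
qed

text \<open>On \<open>W\<close> the points g \<phi>(h.p) and g (h \<phi>(p)) are joined through
  \<phi>(g.(h.p)) = \<phi>((g + h).p). The first distance is the defect of \<open>g\<close> at h.p,
  the second that of \<open>g + h\<close> at p; hence \<open>U\<close> must contain both elements.
  Moving the first one back to p costs the factor \<open>C\<close>, so each \<open>g\<close>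
  contributes \<open>(C + 1) * \<delta>\<close>. Off \<open>W\<close> the trivial bound 1 is used,
  at total cost \<open>e\<close>.\<close>

lemma equivariance_transfer:
  assumes r1: "good_pseudometric act \<rho>1" and r2: "good_pseudometric act \<rho>2"
    and F: "finite F" "F \<subseteq> U" "\<And>g. g \<in> F \<Longrightarrow> g + h \<in> U" and B: "0 \<le> B"
    and dom: "\<And>x y. \<rho>2 x y \<le> \<eta> + B * (\<Sum>g\<in>F. \<rho>1 (act g x) (act g y))"
    and C: "0 < C" "\<And>E. E \<in> sets borel \<Longrightarrow>
      emeasure Haar ((\<lambda>x. - h + x) ` E) \<le> ennreal C * emeasure Haar E"
    and \<phi>: "\<phi> \<in> Map_approx act D \<alpha> vol \<rho>1 U \<delta>"
    and W: "W \<in> sets vol" "emeasure vol (space vol - W) \<le> ennreal e * emeasure vol (space vol)"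
    and Wh: "\<And>p. p \<in> W \<Longrightarrow> (h, p) \<in> D"
    and Wg: "\<And>p g. p \<in> W \<Longrightarrow> g \<in> F \<Longrightarrow> (g, \<alpha> h p) \<in> D \<and> (g + h, p) \<in> D \<and> \<alpha> g (\<alpha> h p) = \<alpha> (g + h) p"
    and nonneg: "0 \<le> \<eta>" "0 \<le> \<delta>" "0 \<le> e"
    and le: "e + \<eta> + B * (real (card F) * ((C + 1) * \<delta>)) < \<delta>'"
  shows "rhoM vol \<rho>2 {p \<in> space vol. (h, p) \<in> D} (\<lambda>p. \<phi> (\<alpha> h p)) (\<lambda>p. act h (\<phi> p)) < ennreal \<delta>'"
proof -
  let ?v = "emeasure vol (space vol)"
  have mea: "\<phi> \<in> measurable vol borel" using \<phi> by (auto simp: Map_approx_def)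
  have act_add: "act (g + h) x = act g (act h x)" for g x using sys by (simp add: G_system_def)
  have D_eq: "{p \<in> space vol. (h, p) \<in> D} = Dom h" by (auto simp: Dom_def space_vol)
  have WD: "W \<subseteq> Dom h" using Wh by (auto simp: mem_Dom)
  have dm: "defect \<rho>1 g \<phi> \<in> borel_measurable vol" for g by (rule measurable_defect[OF r1 mea])
  \<comment> \<open>The defect of \<open>g\<close> read at h.p, cut off to the domain of
    \<open>h\<close> so that it can be integrated over all of M.\<close>
  define t where "t g p = indicator (Dom h) p * defect \<rho>1 g \<phi> (\<alpha> h p)" for g p
  have tm: "t g \<in> borel_measurable vol" for g
  proof -
    have "(\<lambda>p. defect \<rho>1 g \<phi> (\<alpha> h p)) \<in> borel_measurable (restrict_space vol (Dom h))"
      by (rule measurable_compose[OF measurable_act dm])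
    then show ?thesis unfolding t_def
      by (subst (asm) borel_measurable_restrict_space_iff_ennreal) (auto simp: mult.commute)
  qed
  have dbound: "(\<integral>\<^sup>+p. defect \<rho>1 g \<phi> p \<partial>vol) \<le> ennreal \<delta> * ?v" if "g \<in> U" for g
    using Map_approxD(2)[OF \<phi> that] by (rule order_trans[rotated]) simp
  have point: "indicator (space vol - Dom h) p + defect \<rho>2 h \<phi> p \<le>
      indicator (space vol - W) p + ennreal \<eta> + ennreal B * (\<Sum>g\<in>F. t g p + defect \<rho>1 (g + h) \<phi> p)"
    if p: "p \<in> space vol" for p
  proof (cases "p \<in> W")
    case True
    have one: "ennreal (\<rho>1 (act g (\<phi> (\<alpha> h p))) (act g (act h (\<phi> p)))) \<le> t g p + defect \<rho>1 (g + h) \<phi> p"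
      if g: "g \<in> F" for g
    proof -
      have "\<rho>1 (act g (\<phi> (\<alpha> h p))) (act g (act h (\<phi> p))) \<le>
          \<rho>1 (\<phi> (\<alpha> g (\<alpha> h p))) (act g (\<phi> (\<alpha> h p))) + \<rho>1 (\<phi> (\<alpha> (g + h) p)) (act (g + h) (\<phi> p))"
        using good_pseudometricD(4)[OF r1, of "act g (\<phi> (\<alpha> h p))" "act g (act h (\<phi> p))" "\<phi> (\<alpha> g (\<alpha> h p))"]
          good_pseudometricD(3)[OF r1, of "act g (\<phi> (\<alpha> h p))" "\<phi> (\<alpha> g (\<alpha> h p))"] Wg[OF True g] by (simp add: act_add)
      then have "ennreal (\<rho>1 (act g (\<phi> (\<alpha> h p))) (act g (act h (\<phi> p)))) \<le>
          ennreal (\<rho>1 (\<phi> (\<alpha> g (\<alpha> h p))) (act g (\<phi> (\<alpha> h p))) + \<rho>1 (\<phi> (\<alpha> (g + h) p)) (act (g + h) (\<phi> p)))"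
        by (rule ennreal_leI)
      also have "\<dots> = t g p + defect \<rho>1 (g + h) \<phi> p"
        using Wg[OF True g] Wh[OF True] good_pseudometricD(5)[OF r1]
        by (simp add: t_def defect_def mem_Dom ennreal_plus)
      finally show ?thesis .
    qed
    have "indicator (space vol - Dom h) p + defect \<rho>2 h \<phi> p = ennreal (\<rho>2 (\<phi> (\<alpha> h p)) (act h (\<phi> p)))"
      using True WD by (auto simp: defect_def)
    also have "\<dots> \<le> ennreal (\<eta> + B * (\<Sum>g\<in>F. \<rho>1 (act g (\<phi> (\<alpha> h p))) (act g (act h (\<phi> p)))))"
      using dom by (rule ennreal_leI)
    also have "\<dots> = ennreal \<eta> + ennreal B * (\<Sum>g\<in>F. ennreal (\<rho>1 (act g (\<phi> (\<alpha> h p))) (act g (act h (\<phi> p)))))"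
      using B nonneg good_pseudometricD(5)[OF r1] by (simp add: ennreal_plus ennreal_mult sum_nonneg)
    also have "\<dots> \<le> ennreal \<eta> + ennreal B * (\<Sum>g\<in>F. t g p + defect \<rho>1 (g + h) \<phi> p)"
      by (intro add_left_mono mult_left_mono sum_mono one) simp_all
    finally show ?thesis using True by simp
  next
    case False
    have "indicator (space vol - Dom h) p + defect \<rho>2 h \<phi> p \<le> 1"
      using good_pseudometricD(6)[OF r2] by (cases "p \<in> Dom h") (auto simp: defect_def indicator_def)
    also have "1 \<le> indicator (space vol - W) p + ennreal \<eta> + ennreal B * (\<Sum>g\<in>F. t g p + defect \<rho>1 (g + h) \<phi> p)"
      using False p by (simp add: add.assoc)
    finally show ?thesis .
  qed
  have tb: "(\<integral>\<^sup>+p. t g p + defect \<rho>1 (g + h) \<phi> p \<partial>vol) \<le> ennreal ((C + 1) * \<delta>) * ?v" if g: "g \<in> F" for g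
  proof -
    have "(\<integral>\<^sup>+p. t g p + defect \<rho>1 (g + h) \<phi> p \<partial>vol) = (\<integral>\<^sup>+p. t g p \<partial>vol) + (\<integral>\<^sup>+p. defect \<rho>1 (g + h) \<phi> p \<partial>vol)"
      by (rule nn_integral_add[OF tm dm])
    also have "(\<integral>\<^sup>+p. t g p \<partial>vol) \<le> ennreal C * (\<integral>\<^sup>+p. defect \<rho>1 g \<phi> p \<partial>vol)"
      unfolding t_def using C(1) by (intro nn_integral_act_le C(2) dm) auto
    also have "\<dots> \<le> ennreal C * (ennreal \<delta> * ?v)"
      using g F by (intro mult_left_mono dbound) auto
    also have "(\<integral>\<^sup>+p. defect \<rho>1 (g + h) \<phi> p \<partial>vol) \<le> ennreal \<delta> * ?v"
      by (rule dbound[OF F(3)[OF g]])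
    also have "ennreal C * (ennreal \<delta> * ?v) + ennreal \<delta> * ?v = ennreal (C * \<delta> + \<delta>) * ?v"
      using nonneg C(1) by (simp add: ennreal_plus ennreal_mult distrib_right mult.assoc)
    finally show ?thesis by (simp add: algebra_simps)
  qed
  have "emeasure vol (space vol - Dom h) + (\<integral>\<^sup>+p. defect \<rho>2 h \<phi> p \<partial>vol) =
      (\<integral>\<^sup>+p. indicator (space vol - Dom h) p + defect \<rho>2 h \<phi> p \<partial>vol)"
    using measurable_defect[OF r2 mea] by (simp add: nn_integral_add)
  also have "\<dots> \<le> (\<integral>\<^sup>+p. indicator (space vol - W) p + ennreal \<eta> + ennreal B * (\<Sum>g\<in>F. t g p + defect \<rho>1 (g + h) \<phi> p) \<partial>vol)"
    by (intro nn_integral_mono point)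
  also have "\<dots> = emeasure vol (space vol - W) + ennreal \<eta> * ?v + ennreal B * (\<Sum>g\<in>F. \<integral>\<^sup>+p. t g p + defect \<rho>1 (g + h) \<phi> p \<partial>vol)"
  proof -
    have "(\<lambda>p. t g p + defect \<rho>1 (g + h) \<phi> p) \<in> borel_measurable vol" for g
      by (intro borel_measurable_add tm dm)
    then show ?thesis
      using W(1) by (simp add: nn_integral_add nn_integral_cmult nn_integral_sum del: sum.distrib)
  qed
  also have "\<dots> \<le> ennreal e * ?v + ennreal \<eta> * ?v + ennreal B * (\<Sum>g\<in>F. ennreal ((C + 1) * \<delta>) * ?v)"
    by (intro add_mono mult_left_mono sum_mono tb W(2)) simp_all
  also have "\<dots> = ennreal (e + \<eta> + B * (real (card F) * ((C + 1) * \<delta>))) * ?v"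
    using nonneg C(1) B by (simp add: ennreal_plus ennreal_mult distrib_right mult.assoc ennreal_of_nat_eq_real_of_nat)
  finally have "rhoM vol \<rho>2 (Dom h) (\<lambda>p. \<phi> (\<alpha> h p)) (\<lambda>p. act h (\<phi> p))
      \<le> ennreal (e + \<eta> + B * (real (card F) * ((C + 1) * \<delta>)))"
    unfolding rhoM_def defect_def by (rule ennreal_divide_le)
  also have "\<dots> < ennreal \<delta>'"
    using le nonneg C(1) B by (intro ennreal_lessI) (auto intro: add_nonneg_nonneg le_less_trans[rotated])
  finally show ?thesis unfolding D_eq .
qed

end

section \<open>Choice of constants and comparison of the entropies\<close>

lemma elog_mono: "x \<le> y \<Longrightarrow> elog x \<le> elog y"
  by (cases x; cases y) (auto simp: elog_def)

text \<open>For every \<open>U'\<close>, \<open>\<delta>'\<close> there are \<open>U\<close>,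
  \<open>\<delta>\<close> such that, for large \<open>i\<close>, each separated family for
  \<open>\<rho>1\<close> is one for \<open>\<rho>2\<close>. The set \<open>F1\<close> and its
  constants, and with them \<open>\<epsilon>'\<close>, are fixed before \<open>U'\<close> and
  \<open>\<delta>'\<close>.\<close>

lemma rel_entropy_eps_le:
  fixes act :: "'g::{group_add,t2_space,second_countable_topology} \<Rightarrow> 'x::metric_space \<Rightarrow> 'x"
  assumes haar: "lcsc_group_right_haar Haar" and sys: "G_system act"
    and sofic: "sofic_approx Haar M D \<alpha> vol"
    and r1: "good_pseudometric act \<rho>1" and r2: "good_pseudometric act \<rho>2" and "\<epsilon> > 0"
  shows "\<exists>\<epsilon>'>0. rel_entropy_eps act \<pi> D \<alpha> vol \<rho>1 \<epsilon> \<le> rel_entropy_eps act \<pi> D \<alpha> vol \<rho>2 \<epsilon>'"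
proof -
  interpret right_haar Haar by unfold_locales (rule haar)
  obtain V e where V: "\<And>i. open (V i)" "incseq V" "(\<Union>i. V i) = UNIV"
    and e: "e \<longlonglongrightarrow> 0"
    and fin: "\<And>i. emeasure (vol i) (space (vol i)) < \<infinity>"
    and good: "\<And>i. emeasure (vol i) (good_set (M i) (D i) (\<alpha> i) (V i)) \<ge> ennreal (1 - e i) * emeasure (vol i) (space (vol i))"
    using sofic unfolding sofic_approx_def by blast
  have sp: "sofic_space Haar (M i) (D i) (\<alpha> i) (vol i) act" for i
    using sofic fin[of i] sys haar by unfold_locales (auto simp: sofic_approx_def)
  obtain F1 B1 where F1: "finite F1" and B1: "0 \<le> B1"
    and dom1: "\<And>x y. \<rho>1 x y \<le> \<epsilon> / 2 + B1 * (\<Sum>g\<in>F1. \<rho>2 (act g x) (act g y))"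
    using good_pseudometric_dominated[OF sys r1 r2, of "\<epsilon> / 2"] \<open>\<epsilon> > 0\<close> by auto
  have "compact (uminus ` F1)" using F1 by (simp add: finite_imp_compact)
  then obtain C1 where C1: "0 < C1" "\<And>g E. g \<in> F1 \<Longrightarrow> E \<in> sets borel \<Longrightarrow>
      emeasure Haar ((\<lambda>x. - g + x) ` E) \<le> ennreal C1 * emeasure Haar E"
    using Haar_left_translate_bound by (metis image_eqI)
  define T1 where "T1 = B1 * real (card F1)"
  have T1: "0 \<le> T1" using B1 by (simp add: T1_def)
  \<comment> \<open>Half of \<open>\<epsilon>\<close> is spent on the domination error. The rest is
    covered by \<open>T1 * (t / 2)\<close>, where \<open>t / 2\<close> splits into
    \<open>t / 4\<close> for \<open>2 * \<delta>0\<close> and \<open>t / 4\<close> for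
    \<open>C1 * \<epsilon>'\<close>. The summand 1 avoids division by 0.\<close>
  define t where "t = \<epsilon> / (T1 + 1)"
  have t: "t > 0" "T1 * t \<le> \<epsilon>" using \<open>\<epsilon> > 0\<close> T1 by (auto simp: t_def field_simps)
  define \<epsilon>' where "\<epsilon>' = t / (4 * C1)"
  define \<delta>0 where "\<delta>0 = t / 8"
  have pos: "\<epsilon>' > 0" "\<delta>0 > 0" using t C1(1) by (auto simp: \<epsilon>'_def \<delta>0_def)
  have sum1: "\<epsilon> / 2 + B1 * (real (card F1) * (2 * \<delta> + C1 * \<epsilon>')) \<le> \<epsilon>" if "\<delta> \<le> \<delta>0" for \<delta>
  proof -
    have "C1 * \<epsilon>' = t / 4" using C1(1) by (simp add: \<epsilon>'_def)
    then have "2 * \<delta> + C1 * \<epsilon>' \<le> t / 2" using that by (simp add: \<delta>0_def)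
    then have "T1 * (2 * \<delta> + C1 * \<epsilon>') \<le> T1 * (t / 2)" using T1 by (rule mult_left_mono)
    also have "\<dots> \<le> \<epsilon> / 2" using t(2) by simp
    finally show ?thesis unfolding T1_def mult.assoc by linarith
  qed
  have "rel_entropy_eps act \<pi> D \<alpha> vol \<rho>1 \<epsilon> \<le> rel_entropy_eps act \<pi> D \<alpha> vol \<rho>2 \<epsilon>'"
    unfolding rel_entropy_eps_def[of act \<pi> D \<alpha> vol \<rho>2]
  proof (intro INF_greatest)
    fix U' \<delta>' assume "U' \<in> {U::'g set. 0 \<in> interior U \<and> compact (closure U)}" "\<delta>' \<in> {0::real<..}"
    then have U': "0 \<in> interior U'" "compact (closure U')" and \<delta>': "\<delta>' > 0" by auto
    define U2 where "U2 = U' \<union> F1"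
    define \<delta>2 where "\<delta>2 = min \<delta>' \<delta>0"
    have \<delta>2: "\<delta>2 > 0" "\<delta>2 \<le> \<delta>'" "\<delta>2 \<le> \<delta>0" using \<delta>' pos by (auto simp: \<delta>2_def)
    have cU2: "compact (closure U2)"
      unfolding U2_def using U'(2) F1 by (simp add: compact_Un finite_imp_compact finite_imp_closed)
    obtain F2 B2 where F2: "finite F2" and B2: "0 \<le> B2"
      and dom2: "\<And>x y. \<rho>2 x y \<le> \<delta>2 / 4 + B2 * (\<Sum>g\<in>F2. \<rho>1 (act g x) (act g y))"
      using good_pseudometric_dominated[OF sys r2 r1, of "\<delta>2 / 4"] \<delta>2(1) by auto
    \<comment> \<open>Equivariance must be shown for all \<open>h\<close> in the possibly infinite
      set \<open>U2\<close>, so a bound uniform over its compact closure is needed.\<close>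
    have "compact (uminus ` closure U2)"
      using cU2 continuous_on_subset[OF continuous_uminus] by (intro compact_continuous_image) auto
    then obtain C2 where C2: "0 < C2" and C2': "\<And>h E. h \<in> uminus ` closure U2 \<Longrightarrow> E \<in> sets borel \<Longrightarrow>
        emeasure Haar ((\<lambda>x. h + x) ` E) \<le> ennreal C2 * emeasure Haar E"
      using Haar_left_translate_bound by metis
    \<comment> \<open>\<open>U\<close> holds every element at which equivariance for
      \<open>\<rho>1\<close> is invoked, namely each \<open>g\<close> in \<open>F2\<close> and each
      sum \<open>g + h\<close> with \<open>h\<close> in \<open>U2\<close>. The set \<open>L\<close>
      is a compact superset of it.\<close>
    define U where "U = U2 \<union> F2 \<union> (\<Union>g\<in>F2. (\<lambda>h. g + h) ` U2)"
    define L where "L = closure U2 \<union> F2 \<union> (\<Union>g\<in>F2. (\<lambda>h. g + h) ` closure U2)"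
    have L: "compact L"
      unfolding L_def using cU2 F2
      by (intro compact_Un compact_UN cU2 F2 finite_imp_compact[OF F2] compact_continuous_image continuous_group_intros)
    have UL: "U \<subseteq> L" unfolding U_def L_def using closure_subset by blast
    have "closure U \<subseteq> L" using UL L by (simp add: closure_minimal compact_imp_closed)
    then have cU: "compact (closure U)" using L by (metis closed_closure compact_Int_closed inf.absorb_iff2)
    have "U' \<subseteq> U" by (auto simp: U_def U2_def)
    then have U0: "0 \<in> interior U" using U'(1) interior_mono by blast
    define T2 where "T2 = B2 * real (card F2)"
    have T2: "0 \<le> T2" using B2 by (simp add: T2_def)
    \<comment> \<open>A quarter of \<open>\<delta>2\<close> goes to the domination error, a quarter
      to the complement of \<open>W\<close>, and this choice keeps the defects within a third
      quarter; the total is strictly below \<open>\<delta>2\<close>.\<close>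
    define \<delta> where "\<delta> = \<delta>2 / (4 * (T2 + 1) * (C2 + 1))"
    have \<delta>: "\<delta> > 0" using \<delta>2(1) T2 C2 by (simp add: \<delta>_def)
    have sum2: "\<delta>2 / 4 + \<delta>2 / 4 + B2 * (real (card F2) * ((C2 + 1) * \<delta>)) < \<delta>2"
    proof -
      have "(C2 + 1) * \<delta> = \<delta>2 / 4 / (T2 + 1)" using C2 by (simp add: \<delta>_def)
      then have "T2 * ((C2 + 1) * \<delta>) = T2 * (\<delta>2 / 4 / (T2 + 1))" by simp
      also have "\<dots> \<le> \<delta>2 / 4" using T2 \<delta>2(1) by (simp add: field_simps)
      finally show ?thesis using \<delta>2(1) unfolding T2_def mult.assoc by linarith
    qed
    obtain i0 where i0: "L \<subseteq> V i0"
    proof -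
      obtain I where I: "finite I" "L \<subseteq> (\<Union>i\<in>I. V i)"
        by (rule compactE_image[OF L, of UNIV V]) (use V in auto)
      have "(\<Union>i\<in>I. V i) \<subseteq> V (Max (insert 0 I))"
        using I(1) V(2) by (intro UN_least) (simp add: incseqD)
      then show ?thesis by (rule that[OF subset_trans[OF I(2)]])
    qed
    have ev: "eventually (\<lambda>i. i0 \<le> i \<and> e i < min (\<delta>2 / 4) 1) sequentially"
      using e \<delta>2(1) by (intro eventually_conj eventually_ge_at_top order_tendstoD(2)) auto
    have key: "N_rel \<epsilon> (Map_approx act (D i) (\<alpha> i) (vol i) \<rho>1 U \<delta>) (vol i) \<rho>1 \<pi>
        \<le> N_rel \<epsilon>' (Map_approx act (D i) (\<alpha> i) (vol i) \<rho>2 U' \<delta>') (vol i) \<rho>2 \<pi>"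
      if i: "i0 \<le> i" and ei: "e i < min (\<delta>2 / 4) 1" for i
    proof -
      interpret S: sofic_space Haar "M i" "D i" "\<alpha> i" "vol i" act by (rule sp)
      let ?v = "emeasure (vol i) (space (vol i))"
      let ?G = "good_set (M i) (D i) (\<alpha> i) (V i)"
      have LV: "L \<subseteq> V i" using i0 V(2) i by (meson incseqD order_trans)
      text \<open>If \<open>?v = 0\<close>, the hypothesis holds even for a non-measurable \<open>?G\<close>.\<close>
      obtain W where W: "W \<in> sets (vol i)" "W \<subseteq> ?G"
        "emeasure (vol i) (space (vol i) - W) \<le> ennreal (\<delta>2 / 4) * ?v"
      proof (cases "?v = 0")
        case True
        then show ?thesis by (intro that[of "{}"]) auto
      next
        case False
        \<comment> \<open>Since \<open>e i < 1\<close>, the lower bound on the good set is positive.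
          As \<open>emeasure\<close> is 0 on non-measurable sets, positivity proves that
          \<open>?G\<close> is measurable.\<close>
        have "emeasure (vol i) ?G \<noteq> 0"
          using good[of i] False ei by (auto simp: ennreal_eq_0_iff)
        then have G: "?G \<in> sets (vol i)" using emeasure_notin_sets by blast
        have "emeasure (vol i) (space (vol i) - ?G) = ?v - emeasure (vol i) ?G"
          using G fin[of i] sets.sets_into_space[OF G] emeasure_mono[OF sets.sets_into_space[OF G] sets.top]
          by (intro emeasure_compl) auto
        also have "\<dots> \<le> ?v - ennreal (1 - e i) * ?v"
          using good[of i] by (intro ennreal_minus_mono) auto
        also have "\<dots> \<le> ennreal (\<delta>2 / 4) * ?v"
        proof -
          obtain w where w: "?v = ennreal w" "0 \<le> w" using fin[of i] by (cases ?v) auto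
          have "w - (1 - e i) * w = e i * w" by (simp add: algebra_simps)
          also have "\<dots> \<le> \<delta>2 / 4 * w" using ei w(2) by (intro mult_right_mono) auto
          finally show ?thesis
            using ei w(2) \<delta>2(1) unfolding w(1) by (simp add: ennreal_mult[symmetric] ennreal_minus)
        qed
        finally show ?thesis using G by (intro that[of ?G]) auto
      qed
      \<comment> \<open>For \<open>h\<close> in \<open>U2\<close> and \<open>g\<close> in
        \<open>F2\<close> the elements \<open>h\<close>, \<open>g\<close> and \<open>g + h\<close>
        all lie in \<open>L\<close>, hence in \<open>V i\<close>, so that the associativity clause
        of \<open>good_set\<close> applies at the points of \<open>W\<close>.\<close>
      have incl: "\<phi> \<in> Map_approx act (D i) (\<alpha> i) (vol i) \<rho>2 U2 \<delta>2"
        if \<phi>: "\<phi> \<in> Map_approx act (D i) (\<alpha> i) (vol i) \<rho>1 U \<delta>" for \<phi>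
        unfolding Map_approx_def
      proof (intro CollectI conjI ballI)
        show "\<phi> \<in> measurable (vol i) borel" using \<phi> by (simp add: Map_approx_def)
        fix h assume h: "h \<in> U2"
        have hV: "h \<in> V i" using h UL LV by (auto simp: U_def)
        have hc: "- h \<in> uminus ` closure U2" using h closure_subset by blast
        show "rhoM (vol i) \<rho>2 {p \<in> space (vol i). (h, p) \<in> D i} (\<lambda>p. \<phi> (\<alpha> i h p)) (\<lambda>p. act h (\<phi> p)) < ennreal \<delta>2"
        proof (rule S.equivariance_transfer[OF r1 r2 F2 _ _ B2 dom2 C2 C2'[OF hc] \<phi> W(1,3) _ _ _ _ _ sum2])
          show "F2 \<subseteq> U" by (auto simp: U_def)
          show "g + h \<in> U" if "g \<in> F2" for g using that h by (auto simp: U_def)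
          fix p assume p: "p \<in> W"
          then have pG: "p \<in> ?G" using W(2) by blast
          then show "(h, p) \<in> D i" using hV by (auto simp: good_set_def)
          fix g assume g: "g \<in> F2"
          have "g \<in> U" "g + h \<in> U" using g h by (auto simp: U_def)
          then have "g \<in> V i" "g + h \<in> V i" using UL LV by auto
          then show "(g, \<alpha> i h p) \<in> D i \<and> (g + h, p) \<in> D i \<and> \<alpha> i g (\<alpha> i h p) = \<alpha> i (g + h) p"
            using pG hV unfolding good_set_def by blast
        qed (use \<delta> \<delta>2 in auto)
      qed
      have incl': "\<phi> \<in> Map_approx act (D i) (\<alpha> i) (vol i) \<rho>2 U' \<delta>'"
        if "\<phi> \<in> Map_approx act (D i) (\<alpha> i) (vol i) \<rho>2 U2 \<delta>2" for \<phi>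
        using that \<delta>2(2) ennreal_leI[OF \<delta>2(2)] unfolding Map_approx_def U2_def
        by (auto intro: less_le_trans)
      \<comment> \<open>The same family \<open>S\<close> competes in both suprema, so the condition
        on the fibres of \<pi> carries over verbatim.\<close>
      show ?thesis
        unfolding N_rel_def
      proof (rule SUP_subset_mono)
        show "{S. finite S \<and> S \<subseteq> Map_approx act (D i) (\<alpha> i) (vol i) \<rho>1 U \<delta> \<and>
            (\<forall>\<phi>\<in>S. \<forall>\<psi>\<in>S. \<phi> \<noteq> \<psi> \<longrightarrow> rhoM (vol i) \<rho>1 (space (vol i)) \<phi> \<psi> > ennreal \<epsilon>) \<and>
            (\<forall>\<phi>\<in>S. \<forall>\<psi>\<in>S. \<forall>p\<in>space (vol i). \<pi> (\<phi> p) = \<pi> (\<psi> p))}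
          \<subseteq> {S. finite S \<and> S \<subseteq> Map_approx act (D i) (\<alpha> i) (vol i) \<rho>2 U' \<delta>' \<and>
            (\<forall>\<phi>\<in>S. \<forall>\<psi>\<in>S. \<phi> \<noteq> \<psi> \<longrightarrow> rhoM (vol i) \<rho>2 (space (vol i)) \<phi> \<psi> > ennreal \<epsilon>') \<and>
            (\<forall>\<phi>\<in>S. \<forall>\<psi>\<in>S. \<forall>p\<in>space (vol i). \<pi> (\<phi> p) = \<pi> (\<psi> p))}" (is "?L \<subseteq> ?R")
        proof
          fix S assume SL: "S \<in> ?L"
          have S: "finite S" "S \<subseteq> Map_approx act (D i) (\<alpha> i) (vol i) \<rho>1 U \<delta>"
            using SL by blast+
          have sep: "\<forall>\<phi>\<in>S. \<forall>\<psi>\<in>S. \<phi> \<noteq> \<psi> \<longrightarrow> rhoM (vol i) \<rho>1 (space (vol i)) \<phi> \<psi> > ennreal \<epsilon>"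
            using SL by blast
          have fibre: "\<forall>\<phi>\<in>S. \<forall>\<psi>\<in>S. \<forall>p\<in>space (vol i). \<pi> (\<phi> p) = \<pi> (\<psi> p)"
            using SL by blast
          have "rhoM (vol i) \<rho>2 (space (vol i)) \<phi> \<psi> > ennreal \<epsilon>'"
            if \<phi>\<psi>: "\<phi> \<in> S" "\<psi> \<in> S" "\<phi> \<noteq> \<psi>" for \<phi> \<psi>
          proof (rule ccontr)
            assume "\<not> rhoM (vol i) \<rho>2 (space (vol i)) \<phi> \<psi> > ennreal \<epsilon>'"
            then have close: "rhoM (vol i) \<rho>2 (space (vol i)) \<phi> \<psi> \<le> ennreal \<epsilon>'" by simp
            have "rhoM (vol i) \<rho>1 (space (vol i)) \<phi> \<psi> \<le> ennreal \<epsilon>"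
              by (rule S.separation_transfer[OF r1 r2 F1 _ B1 dom1 C1 _ _ close _ _ _ sum1[OF \<delta>2(3)], where U = U2])
                (use S \<phi>\<psi> incl pos \<delta>2 \<open>\<epsilon> > 0\<close> in \<open>auto simp: U2_def\<close>)
            then show False using sep \<phi>\<psi> by (meson not_le)
          qed
          moreover have "S \<subseteq> Map_approx act (D i) (\<alpha> i) (vol i) \<rho>2 U' \<delta>'"
            using S(2) incl incl' by blast
          ultimately show "S \<in> ?R"
            using S(1) fibre by blast
        qed
      qed simp
    qed
    have "rel_entropy_eps act \<pi> D \<alpha> vol \<rho>1 \<epsilon> \<le>
      limsup (\<lambda>i. ereal (1 / measure (vol i) (space (vol i))) *
          elog (N_rel \<epsilon> (Map_approx act (D i) (\<alpha> i) (vol i) \<rho>1 U \<delta>) (vol i) \<rho>1 \<pi>))"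
      unfolding rel_entropy_eps_def using U0 cU \<delta>
      by (intro INF_lower2[of U] INF_lower2[of \<delta>]) simp_all
    also have "\<dots> \<le> limsup (\<lambda>i. ereal (1 / measure (vol i) (space (vol i))) *
          elog (N_rel \<epsilon>' (Map_approx act (D i) (\<alpha> i) (vol i) \<rho>2 U' \<delta>') (vol i) \<rho>2 \<pi>))"
      by (rule Limsup_mono, rule eventually_mono[OF ev])
        (auto intro!: ereal_mult_left_mono elog_mono key)
    finally show "rel_entropy_eps act \<pi> D \<alpha> vol \<rho>1 \<epsilon> \<le> limsup (\<lambda>i. ereal (1 / measure (vol i) (space (vol i))) *
          elog (N_rel \<epsilon>' (Map_approx act (D i) (\<alpha> i) (vol i) \<rho>2 U' \<delta>') (vol i) \<rho>2 \<pi>))" .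
  qed
  then show ?thesis using pos(1) by blast
qed

lemma rel_entropy_le:
  fixes act :: "'g::{group_add,t2_space,second_countable_topology} \<Rightarrow> 'x::metric_space \<Rightarrow> 'x"
  assumes "lcsc_group_right_haar Haar" "G_system act" "sofic_approx Haar M D \<alpha> vol"
    "good_pseudometric act \<rho>1" "good_pseudometric act \<rho>2"
  shows "rel_entropy act \<pi> D \<alpha> vol \<rho>1 \<le> rel_entropy act \<pi> D \<alpha> vol \<rho>2"
  unfolding rel_entropy_def
proof (rule SUP_least)
  fix \<epsilon> :: real assume "\<epsilon> \<in> {0<..}"
  then obtain \<epsilon>' where "\<epsilon>' > 0" "rel_entropy_eps act \<pi> D \<alpha> vol \<rho>1 \<epsilon> \<le> rel_entropy_eps act \<pi> D \<alpha> vol \<rho>2 \<epsilon>'"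
    using rel_entropy_eps_le[OF assms] by auto
  then show "rel_entropy_eps act \<pi> D \<alpha> vol \<rho>1 \<epsilon> \<le> (SUP \<epsilon> \<in> {0<..}. rel_entropy_eps act \<pi> D \<alpha> vol \<rho>2 \<epsilon>)"
    by (intro SUP_upper2[of \<epsilon>']) auto
qed

theorem mainTheorem2:
  fixes Haar :: "'g::{group_add,t2_space,second_countable_topology} measure"
    and actX :: "'g \<Rightarrow> 'x::metric_space \<Rightarrow> 'x"
    and actY :: "'g \<Rightarrow> 'y::metric_space \<Rightarrow> 'y"
    and \<pi> :: "'x \<Rightarrow> 'y"
    and M :: "nat \<Rightarrow> 'm topology"
    and D :: "nat \<Rightarrow> ('g \<times> 'm) set"
    and \<alpha> :: "nat \<Rightarrow> 'g \<Rightarrow> 'm \<Rightarrow> 'm"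
    and vol :: "nat \<Rightarrow> 'm measure"
    and \<rho>1 \<rho>2 :: "'x \<Rightarrow> 'x \<Rightarrow> real"
  assumes "lcsc_group_right_haar Haar"
    and "G_system actX" and "G_system actY"
    and "factor_map actX actY \<pi>"
    and "sofic_approx Haar M D \<alpha> vol"
    and "good_pseudometric actX \<rho>1"
    and "good_pseudometric actX \<rho>2"
  shows "rel_entropy actX \<pi> D \<alpha> vol \<rho>1 = rel_entropy actX \<pi> D \<alpha> vol \<rho>2"
  using rel_entropy_le[OF assms(1,2,5,6,7)] rel_entropy_le[OF assms(1,2,5,7,6)] by (rule antisym)

end
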